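(* Every non-null odd-quadratic odd-symplectic Lie superalgebra is obtained from $\{0\}$ by a finite sequence of generalized odd double extensions by the one-dimensional Lie superalgebra with null even part.
   Context: All Lie superalgebras are finite dimensional over an algebraically closed field $\mathbb K$ of characteristic zero; $|x|\in\mathbb Z_2$ is the degree of a homogeneous $X$; "non-null" means nonzero. A bilinear form on $\mathfrak g$ is odd if it vanishes on $\mathfrak g_\alpha\times\mathfrak g_\alpha$ for all $\alpha\in\mathbb Z_2$. An odd-invariant scalar product $B$ on $\mathfrak g$ is an odd, supersymmetric ($B(X,Y)=(-1)^{|x||y|}B(Y,X)$), invariant ($B([X,Y],Z)=B(X,[Y,Z])$), non-degenerate bilinear form. An odd-symplectic form is an odd, skew-supersymmetric ($\omega(X,Y)=-(-1)^{|x||y|}\omega(Y,X)$), non-degenerate bilinear form with $(-1)^{|z||x|}\omega(X,[Y,Z])+(-1)^{|x||y|}\omega(Y,[Z,X])+(-1)^{|y||z|}\omega(Z,[X,Y])=0$. An odd-quadratic odd-symplectic Lie superalgebra $(\mathfrak g,B,\omega)$ is a Lie superalgebra with an odd-invariant scalar product $B$ and an odd-symplectic form $\omega$; then there is a unique even invertible superderivation $\delta$ with $\omega(X,Y)=B(\delta(X),Y)$, and it is skew-supersymmetric. A superderivation $\Delta$ of degree $d$ satisfies $\Delta(\mathfrak g_\alpha)\subseteq \mathfrak g_{\alpha+d}$ and $\Delta[X,Y]=[\Delta(X),Y]+(-1)^{d|x|}[X,\Delta(Y)]$; it is skew-supersymmetric for $B$ if $B(\Delta(X),Y)=-(-1)^{d|x|}B(X,\Delta(Y))$.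 $[\delta,\bar D]$ denotes the supercommutator. Generalized odd double extension by the one-dimensional Lie superalgebra with null even part. Let $(\mathfrak h,B,\omega)$ be odd-quadratic odd-symplectic with associated even invertible superderivation $\delta$. Let $\bar D$ be an odd skew-supersymmetric superderivation of $(\mathfrak h,B)$, $x_0\in\mathfrak h_{\bar0}$, $k\in\mathbb K$, $c_1\in\mathfrak h_{\bar1}$ and $\lambda\in\mathbb K\setminus\{0\}$ such that $\bar D(x_0)=0$, $\bar D^2=\frac12\mathrm{ad}_{\mathfrak h}(x_0)$, $B(c_1,x_0)=\lambda k$, $2\bar D(c_1)=\delta(x_0)+2\lambda x_0$, $[\delta,\bar D]+\lambda\bar D=\mathrm{ad}_{\mathfrak h}(c_1)$. On $\widetilde{\mathfrak g}=\mathbb Ke^*\oplus\mathfrak h\oplus\mathbb Ke$ ($e$ odd, $e^*$ even) define the bracket by $[e,e]=x_0+ke^*$, $[e,X]=\bar D(X)+B(x_0,X)e^*$, $[X,Y]=[X,Y]_{\mathfrak h}+B(\bar D(X),Y)e^*$ for $X,Y\in\mathfrak h$, $e^*$ central; the supersymmetric form $\widetilde B$ by $\widetilde B|_{\mathfrak h\times\mathfrak h}=B$, $\widetilde B(e^*,e)=1$, all other pairings zero; and $\Delta$ by $\Delta(e^* )=\lambda e^*$, $\Delta(X)=\delta(X)-B(c_1,X)e^*$, $\Delta(e)=-\lambda e+c_1$. Then $(\widetilde{\mathfrak g},\widetilde B,\widetilde\omega)$ with $\widetilde\omega(\cdot,\cdot)=\widetilde B(\Delta(\cdot),\cdot)$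 is an odd-quadratic odd-symplectic Lie superalgebra, called the generalized odd double extension of $(\mathfrak h,B,\omega)$ by means of $(\bar D,x_0,c_1,\lambda)$. "Is obtained" is up to isomorphism of Lie superalgebras preserving both forms. *)

theory Defs
  imports
    "HOL-Computational_Algebra.Polynomial"
    "HOL-Library.Z2"
    "HOL-Library.Product_Plus"
begin

text \<open>
  A superalgebra lives on a subspace (its carrier) of an ambient vector space, so that algebras of
  different dimensions can share one type. All operations are total functions of which only the
  values on the carrier matter. Degrees are elements of the two-element field \<^typ>\<open>bit\<close>.
\<close>

record ('k, 'v) superalgebra =
  scl :: "'k \<Rightarrow> 'v \<Rightarrow> 'v"
  hpart :: "bit \<Rightarrow> 'v set"
  brk :: "'v \<Rightarrow> 'v \<Rightarrow> 'v"

record ('k, 'v) superalgebra_forms = "('k, 'v) superalgebra" +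
  Bform :: "'v \<Rightarrow> 'v \<Rightarrow> 'k"
  symp :: "'v \<Rightarrow> 'v \<Rightarrow> 'k"

text \<open>The sign \<open>(-1)\<^sup>a\<^sup>b\<close> for degrees \<open>a\<close>, \<open>b\<close>.\<close>

definition ksign :: "bit \<Rightarrow> bit \<Rightarrow> 'k::ring_1" where
  "ksign a b = (if a = 1 \<and> b = 1 then - 1 else 1)"

definition carr :: "('k, 'v::plus, 'z) superalgebra_scheme \<Rightarrow> 'v set" where
  "carr g = {X + Y |X Y. X \<in> hpart g 0 \<and> Y \<in> hpart g 1}"

definition linear_map_on ::
  "'v set \<Rightarrow> ('k \<Rightarrow> 'v::plus \<Rightarrow> 'v) \<Rightarrow> ('k \<Rightarrow> 'w::plus \<Rightarrow> 'w) \<Rightarrow> ('v \<Rightarrow> 'w) \<Rightarrow> bool" where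
  "linear_map_on V s s' f \<longleftrightarrow>
     (\<forall>X\<in>V. \<forall>Y\<in>V. f (X + Y) = f X + f Y) \<and> (\<forall>c. \<forall>X\<in>V. f (s c X) = s' c (f X))"

definition bilinear_map_on ::
  "'v set \<Rightarrow> ('k \<Rightarrow> 'v::plus \<Rightarrow> 'v) \<Rightarrow> ('k \<Rightarrow> 'w::plus \<Rightarrow> 'w) \<Rightarrow> ('v \<Rightarrow> 'v \<Rightarrow> 'w) \<Rightarrow> bool" where
  "bilinear_map_on V s s' f \<longleftrightarrow>
     (\<forall>X\<in>V. linear_map_on V s s' (\<lambda>Y. f X Y)) \<and> (\<forall>Y\<in>V. linear_map_on V s s' (\<lambda>X. f X Y))"

definition lie_superalgebra ::
  "('k::field, 'v::ab_group_add, 'z) superalgebra_scheme \<Rightarrow> bool" where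
  "lie_superalgebra g \<longleftrightarrow>
     vector_space (scl g) \<and>
     (\<forall>\<alpha>. module.subspace (scl g) (hpart g \<alpha>)) \<and>
     hpart g 0 \<inter> hpart g 1 = {0} \<and>
     (\<exists>S. finite S \<and> carr g \<subseteq> module.span (scl g) S) \<and>
     bilinear_map_on (carr g) (scl g) (scl g) (brk g) \<and>
     (\<forall>\<alpha> \<beta>. \<forall>X\<in>hpart g \<alpha>. \<forall>Y\<in>hpart g \<beta>. brk g X Y \<in> hpart g (\<alpha> + \<beta>)) \<and>
     (\<forall>\<alpha> \<beta>. \<forall>X\<in>hpart g \<alpha>. \<forall>Y\<in>hpart g \<beta>.
        brk g X Y = - scl g (ksign \<alpha> \<beta>) (brk g Y X)) \<and>
     (\<forall>\<alpha> \<beta> \<gamma>. \<forall>X\<in>hpart g \<alpha>. \<forall>Y\<in>hpart g \<beta>. \<forall>Z\<in>hpart g \<gamma>.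
        scl g (ksign \<alpha> \<gamma>) (brk g X (brk g Y Z))
        + scl g (ksign \<beta> \<alpha>) (brk g Y (brk g Z X))
        + scl g (ksign \<gamma> \<beta>) (brk g Z (brk g X Y)) = 0)"

definition odd_form ::
  "('k::field, 'v::ab_group_add, 'z) superalgebra_scheme \<Rightarrow> ('v \<Rightarrow> 'v \<Rightarrow> 'k) \<Rightarrow> bool" where
  "odd_form g F \<longleftrightarrow>
     bilinear_map_on (carr g) (scl g) (*) F \<and>
     (\<forall>\<alpha>. \<forall>X\<in>hpart g \<alpha>. \<forall>Y\<in>hpart g \<alpha>. F X Y = 0)"

definition nondegenerate_form ::
  "('k::field, 'v::ab_group_add, 'z) superalgebra_scheme \<Rightarrow> ('v \<Rightarrow> 'v \<Rightarrow> 'k) \<Rightarrow> bool" where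
  "nondegenerate_form g F \<longleftrightarrow> (\<forall>X\<in>carr g. (\<forall>Y\<in>carr g. F X Y = 0) \<longrightarrow> X = 0)"

definition odd_invariant_scalar_product ::
  "('k::field, 'v::ab_group_add, 'z) superalgebra_scheme \<Rightarrow> ('v \<Rightarrow> 'v \<Rightarrow> 'k) \<Rightarrow> bool" where
  "odd_invariant_scalar_product g B \<longleftrightarrow>
     odd_form g B \<and> nondegenerate_form g B \<and>
     (\<forall>\<alpha> \<beta>. \<forall>X\<in>hpart g \<alpha>. \<forall>Y\<in>hpart g \<beta>. B X Y = ksign \<alpha> \<beta> * B Y X) \<and>
     (\<forall>X\<in>carr g. \<forall>Y\<in>carr g. \<forall>Z\<in>carr g. B (brk g X Y) Z = B X (brk g Y Z))"

definition odd_symplectic_form ::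
  "('k::field, 'v::ab_group_add, 'z) superalgebra_scheme \<Rightarrow> ('v \<Rightarrow> 'v \<Rightarrow> 'k) \<Rightarrow> bool" where
  "odd_symplectic_form g \<omega> \<longleftrightarrow>
     odd_form g \<omega> \<and> nondegenerate_form g \<omega> \<and>
     (\<forall>\<alpha> \<beta>. \<forall>X\<in>hpart g \<alpha>. \<forall>Y\<in>hpart g \<beta>. \<omega> X Y = - (ksign \<alpha> \<beta> * \<omega> Y X)) \<and>
     (\<forall>\<alpha> \<beta> \<gamma>. \<forall>X\<in>hpart g \<alpha>. \<forall>Y\<in>hpart g \<beta>. \<forall>Z\<in>hpart g \<gamma>.
        ksign \<gamma> \<alpha> * \<omega> X (brk g Y Z)
        + ksign \<alpha> \<beta> * \<omega> Y (brk g Z X)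
        + ksign \<beta> \<gamma> * \<omega> Z (brk g X Y) = 0)"

definition odd_quadratic_odd_symplectic ::
  "('k::field, 'v::ab_group_add) superalgebra_forms \<Rightarrow> bool" where
  "odd_quadratic_odd_symplectic g \<longleftrightarrow>
     lie_superalgebra g \<and> odd_invariant_scalar_product g (Bform g) \<and>
     odd_symplectic_form g (symp g)"

definition superderivation ::
  "('k::field, 'v::ab_group_add, 'z) superalgebra_scheme \<Rightarrow> bit \<Rightarrow> ('v \<Rightarrow> 'v) \<Rightarrow> bool" where
  "superderivation g d \<Delta> \<longleftrightarrow>
     linear_map_on (carr g) (scl g) (scl g) \<Delta> \<and>
     (\<forall>\<alpha>. \<Delta> ` hpart g \<alpha> \<subseteq> hpart g (\<alpha> + d)) \<and>
     (\<forall>\<alpha>. \<forall>X\<in>hpart g \<alpha>. \<forall>Y\<in>carr g.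
        \<Delta> (brk g X Y) = brk g (\<Delta> X) Y + scl g (ksign d \<alpha>) (brk g X (\<Delta> Y)))"

definition skew_supersymmetric ::
  "('k::field, 'v::ab_group_add) superalgebra_forms \<Rightarrow> bit \<Rightarrow> ('v \<Rightarrow> 'v) \<Rightarrow> bool" where
  "skew_supersymmetric g d \<Delta> \<longleftrightarrow>
     (\<forall>\<alpha>. \<forall>X\<in>hpart g \<alpha>. \<forall>Y\<in>carr g. Bform g (\<Delta> X) Y = - (ksign d \<alpha> * Bform g X (\<Delta> Y)))"

definition supercommutator ::
  "('k::field, 'v::ab_group_add, 'z) superalgebra_scheme \<Rightarrow> bit \<Rightarrow> bit \<Rightarrow>
     ('v \<Rightarrow> 'v) \<Rightarrow> ('v \<Rightarrow> 'v) \<Rightarrow> 'v \<Rightarrow> 'v" where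
  "supercommutator g d d' S T = (\<lambda>X. S (T X) - scl g (ksign d d') (T (S X)))"

text \<open>The even invertible superderivation linking the two forms; it is unique on the carrier.\<close>

definition associated_derivation ::
  "('k::field, 'v::ab_group_add) superalgebra_forms \<Rightarrow> ('v \<Rightarrow> 'v) \<Rightarrow> bool" where
  "associated_derivation g \<delta> \<longleftrightarrow>
     superderivation g 0 \<delta> \<and> bij_betw \<delta> (carr g) (carr g) \<and>
     (\<forall>X\<in>carr g. \<forall>Y\<in>carr g. symp g X Y = Bform g (\<delta> X) Y)"

definition homogeneous_component ::
  "('k, 'v::ab_group_add, 'z) superalgebra_scheme \<Rightarrow> bit \<Rightarrow> 'v \<Rightarrow> 'v" where
  "homogeneous_component g \<alpha> X = (THE Y. Y \<in> hpart g \<alpha> \<and> X - Y \<in> hpart g (\<alpha> + 1))"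

text \<open>The linear map with \<open>X \<mapsto> (-1)\<^sup>|\<^sup>X\<^sup>| X\<close> on homogeneous \<open>X\<close>.\<close>

definition parity_map ::
  "('k, 'v::ab_group_add, 'z) superalgebra_scheme \<Rightarrow> 'v \<Rightarrow> 'v" where
  "parity_map g X = homogeneous_component g 0 X - homogeneous_component g 1 X"

definition extension_data ::
  "('k::field, 'v::ab_group_add) superalgebra_forms \<Rightarrow> ('v \<Rightarrow> 'v) \<Rightarrow>
     ('v \<Rightarrow> 'v) \<Rightarrow> 'v \<Rightarrow> 'k \<Rightarrow> 'v \<Rightarrow> 'k \<Rightarrow> bool" where
  "extension_data h \<delta> D x\<^sub>0 k c\<^sub>1 l \<longleftrightarrow>
     odd_quadratic_odd_symplectic h \<and> associated_derivation h \<delta> \<and>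
     superderivation h 1 D \<and> skew_supersymmetric h 1 D \<and>
     x\<^sub>0 \<in> hpart h 0 \<and> c\<^sub>1 \<in> hpart h 1 \<and> l \<noteq> 0 \<and>
     D x\<^sub>0 = 0 \<and>
     (\<forall>X\<in>carr h. D (D X) = scl h (1 / 2) (brk h x\<^sub>0 X)) \<and>
     Bform h c\<^sub>1 x\<^sub>0 = l * k \<and>
     scl h 2 (D c\<^sub>1) = \<delta> x\<^sub>0 + scl h (2 * l) x\<^sub>0 \<and>
     (\<forall>X\<in>carr h. supercommutator h 0 1 \<delta> D X + scl h l (D X) = brk h c\<^sub>1 X)"

text \<open>
  A triple \<open>(a, X, b)\<close> stands for \<open>a e\<^sup>* + X + b e\<close>. The two summands of the bracket carrying
  \<open>parity_map\<close> come from \<open>[X, e] = - (-1)\<^sup>|\<^sup>X\<^sup>| [e, X]\<close>.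
\<close>

definition ext_form ::
  "('k::field, 'v) superalgebra_forms \<Rightarrow> 'k \<times> 'v \<times> 'k \<Rightarrow> 'k \<times> 'v \<times> 'k \<Rightarrow> 'k" where
  "ext_form h = (\<lambda>(a, X, b) (a', X', b'). Bform h X X' + a * b' + b * a')"

definition ext_bracket ::
  "('k::field, 'v::ab_group_add) superalgebra_forms \<Rightarrow> ('v \<Rightarrow> 'v) \<Rightarrow> 'v \<Rightarrow> 'k \<Rightarrow>
     'k \<times> 'v \<times> 'k \<Rightarrow> 'k \<times> 'v \<times> 'k \<Rightarrow> 'k \<times> 'v \<times> 'k" where
  "ext_bracket h D x\<^sub>0 k = (\<lambda>(a, X, b) (a', X', b').
     (Bform h (D X) X' + b * Bform h x\<^sub>0 X' - b' * Bform h x\<^sub>0 (parity_map h X) + b * b' * k,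
      brk h X X' + scl h b (D X') - scl h b' (D (parity_map h X)) + scl h (b * b') x\<^sub>0,
      0))"

definition ext_derivation ::
  "('k::field, 'v::ab_group_add) superalgebra_forms \<Rightarrow> ('v \<Rightarrow> 'v) \<Rightarrow> 'v \<Rightarrow> 'k \<Rightarrow>
     'k \<times> 'v \<times> 'k \<Rightarrow> 'k \<times> 'v \<times> 'k" where
  "ext_derivation h \<delta> c\<^sub>1 l = (\<lambda>(a, X, b). (l * a - Bform h c\<^sub>1 X, \<delta> X + scl h b c\<^sub>1, - (l * b)))"

definition gen_odd_double_ext ::
  "('k::field, 'v::ab_group_add) superalgebra_forms \<Rightarrow> ('v \<Rightarrow> 'v) \<Rightarrow>
     ('v \<Rightarrow> 'v) \<Rightarrow> 'v \<Rightarrow> 'k \<Rightarrow> 'v \<Rightarrow> 'k \<Rightarrow> ('k, 'k \<times> 'v \<times> 'k) superalgebra_forms" where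
  "gen_odd_double_ext h \<delta> D x\<^sub>0 k c\<^sub>1 l =
     \<lparr> scl = (\<lambda>c (a, X, b). (c * a, scl h c X, c * b)),
       hpart = (\<lambda>\<alpha>. if \<alpha> = 0 then UNIV \<times> hpart h 0 \<times> {0} else {0} \<times> hpart h 1 \<times> UNIV),
       brk = ext_bracket h D x\<^sub>0 k,
       Bform = ext_form h,
       symp = (\<lambda>P Q. ext_form h (ext_derivation h \<delta> c\<^sub>1 l P) Q) \<rparr>"

definition isomorphic_forms ::
  "('k, 'v::plus) superalgebra_forms \<Rightarrow> ('k, 'w::plus) superalgebra_forms \<Rightarrow> bool" where
  "isomorphic_forms g g' \<longleftrightarrow>
     (\<exists>\<phi>. linear_map_on (carr g) (scl g) (scl g') \<phi> \<and>
          bij_betw \<phi> (carr g) (carr g') \<and>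
          (\<forall>\<alpha>. \<phi> ` hpart g \<alpha> \<subseteq> hpart g' \<alpha>) \<and>
          (\<forall>X\<in>carr g. \<forall>Y\<in>carr g.
             \<phi> (brk g X Y) = brk g' (\<phi> X) (\<phi> Y) \<and>
             Bform g' (\<phi> X) (\<phi> Y) = Bform g X Y \<and>
             symp g' (\<phi> X) (\<phi> Y) = symp g X Y))"

text \<open>One step: \<open>g\<close> is, up to isomorphism, a generalized odd double extension of \<open>h\<close>.\<close>

definition is_gen_odd_double_ext ::
  "('k::field, 'v::ab_group_add) superalgebra_forms \<Rightarrow> ('k, 'v) superalgebra_forms \<Rightarrow> bool" where
  "is_gen_odd_double_ext h g \<longleftrightarrow>
     odd_quadratic_odd_symplectic g \<and>
     (\<exists>\<delta> D x\<^sub>0 k c\<^sub>1 l. extension_data h \<delta> D x\<^sub>0 k c\<^sub>1 l \<and>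
        isomorphic_forms g (gen_odd_double_ext h \<delta> D x\<^sub>0 k c\<^sub>1 l))"

definition null_superalgebra ::
  "('k::zero \<Rightarrow> 'v::zero \<Rightarrow> 'v) \<Rightarrow> ('k, 'v) superalgebra_forms" where
  "null_superalgebra s =
     \<lparr> scl = s, hpart = (\<lambda>\<alpha>. {0}), brk = (\<lambda>X Y. 0), Bform = (\<lambda>X Y. 0), symp = (\<lambda>X Y. 0) \<rparr>"

end

theory Submission
  imports Defs
begin

text \<open>
  The proof is an induction on the dimension: a nonzero odd-quadratic odd-symplectic Lie
  superalgebra \<open>g\<close> is recovered from a smaller one, which is obtained by cutting out an isotropic
  line \<open>K e\<^sup>*\<close> together with a line \<open>K e\<close> that is dual to it. What has to be found is an even vector
  \<open>e\<^sup>*\<close> that is both central and an eigenvector of the derivation \<open>\<delta>\<close> with \<open>\<omega>(X, Y) = B(\<delta> X, Y)\<close>;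
  this \<open>\<delta>\<close> exists and is invertible because both forms are non-degenerate
  (\<open>associated_derivation_exists\<close>).

  The even part of \<open>g\<close> is an ordinary Lie algebra on which \<open>\<delta>\<close> acts as an invertible derivation.
  Brackets add generalized eigenvalues and, in characteristic zero, adding a nonzero eigenvalue
  again and again soon leaves the finite spectrum. So every generalized eigenvector of \<open>\<delta>\<close> acts
  nilpotently, and an Engel-type theorem for the bracket-closed set of these vectors
  (\<open>weakly_closed_Engel\<close>, after Jacobson) yields a central one. The centre is \<open>\<delta>\<close>-invariant, so it
  contains an eigenvector (\<open>central_eigenvector\<close>). An element central in the even part is central
  in \<open>g\<close>, since the odd form \<open>B\<close> is invariant and makes the odd part the dual of the even part
  (\<open>even_central_eigenvector\<close>).

  Choose an odd \<open>e\<close> with \<open>B(e\<^sup>*, e) = 1\<close>, and let \<open>h\<close> be the orthogonal of the plane spanned by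
  \<open>e\<^sup>*\<close> and \<open>e\<close>. As the orthogonal of \<open>e\<^sup>*\<close> is an ideal which is the sum of \<open>h\<close> and the central line
  \<open>K e\<^sup>*\<close>, the space \<open>h\<close> is the quotient of that ideal by this line; it carries the projected bracket
  and the restrictions of both forms. The data of the extension are components of known
  elements: \<open>D\<close> is the projection of \<open>ad e\<close>, \<open>x\<^sub>0\<close> and \<open>k\<close> are the components of \<open>[e, e]\<close>, and
  \<open>c\<^sub>1\<close> is that of \<open>\<delta> e\<close>. Their compatibility conditions are the components of the Jacobi identity
  for \<open>e, e, X\<close> and \<open>e, e, e\<close> and of the Leibniz rule of \<open>\<delta>\<close> on \<open>[e, e]\<close> and \<open>[e, X]\<close>
  (\<open>extension_data_reduction\<close>), and taking coordinates with respect to \<open>e\<^sup>*\<close>, \<open>h\<close>, \<open>e\<close> is the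
  required isomorphism (\<open>is_gen_odd_double_ext_reduction\<close>).
\<close>

section \<open>Linear algebra in finitely spanned subspaces\<close>

context vector_space
begin

lemma dim_less_of_proper_span:
  assumes "finite S" "A \<subseteq> span S" "B \<subseteq> span A" "a \<in> span A" "a \<notin> span B"
  shows "dim B < dim A"
proof -
  obtain b where b: "b \<subseteq> B" "independent b" "B \<subseteq> span b" "card b = dim B"
    using basis_exists by metis
  obtain c where c: "c \<subseteq> A" "independent c" "A \<subseteq> span c" "card c = dim A"
    using basis_exists by metis
  have "c \<subseteq> span S" using c(1) assms(2) by (rule subset_trans)
  then have "finite c"
    using independent_span_bound[OF assms(1) c(2)] by simp
  have Ac: "span A = span c"
    using c(1,3) by (intro antisym span_mono span_minimal subspace_span)
  have Bb: "span B = span b"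
    using b(1,3) by (intro antisym span_mono span_minimal subspace_span)
  have "independent (insert a b)"
    using b(2) assms(5) Bb by (simp add: independent_insertI)
  moreover have "insert a b \<subseteq> span c"
    using assms(3,4) b(1) Ac by auto
  ultimately have "finite (insert a b) \<and> card (insert a b) \<le> card c"
    by (intro independent_span_bound \<open>finite c\<close>)
  moreover have "a \<notin> b"
    using assms(5) Bb span_base[of a b] by auto
  ultimately have "Suc (card b) \<le> card c" by (auto simp: card_insert_if)
  then show ?thesis using b(4) c(4) by simp
qed

lemma sequence_meets_earlier_span:
  assumes "finite S" "\<And>n. f n \<in> span S"
  shows "\<exists>n. f n \<in> span (f ` {..<n::nat})"
proof (rule ccontr)
  assume *: "\<nexists>n. f n \<in> span (f ` {..<n})"
  have indep: "independent (f ` {..<n}) \<and> card (f ` {..<n}) = n" for n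
  proof (induction n)
    case (Suc n)
    have "f n \<notin> f ` {..<n}" using * span_base[of "f n" "f ` {..<n}"] by blast
    with Suc * show ?case
      by (simp add: lessThan_Suc independent_insertI)
  qed (simp add: independent_empty)
  have "f ` {..<Suc (card S)} \<subseteq> span S" using assms(2) by auto
  then show False
    using independent_span_bound[OF assms(1), of "f ` {..<Suc (card S)}"]
      indep[of "Suc (card S)"] by simp
qed

text \<open>
  A functional that vanishes on the common kernel of finitely many others is a combination of
  them: by induction this holds on the kernel of one of them, and what is then missing is a
  multiple of that one. Applied to the functionals that a non-degenerate form attaches to a basis, it
  yields the vectors that represent functionals by the form.
\<close>

lemma functional_in_span:
  assumes "finite I" "subspace V"
    and f: "linear_map_on V scale (*) f"
    and F: "\<And>i. i \<in> I \<Longrightarrow> linear_map_on V scale (*) (F i)"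
    and ker: "\<And>v. v \<in> V \<Longrightarrow> (\<And>i. i \<in> I \<Longrightarrow> F i v = 0) \<Longrightarrow> f v = 0"
  shows "\<exists>c. \<forall>v\<in>V. f v = (\<Sum>i\<in>I. c i * F i v)"
  using assms
proof (induction I arbitrary: V rule: finite_induct)
  case empty
  then show ?case by auto
next
  case (insert j I)
  define V' where "V' = {v \<in> V. F j v = 0}"
  have Fj: "linear_map_on V scale (*) (F j)" using insert.prems(3) by simp
  have sub: "subspace V'"
    unfolding V'_def using insert.prems(1) Fj
    by (auto simp: subspace_def linear_map_on_def) (metis mult_zero_right scale_zero_left mult_zero_left)
  have "linear_map_on V' scale (*) f" "\<And>i. i \<in> I \<Longrightarrow> linear_map_on V' scale (*) (F i)"
    using insert.prems(2,3) by (auto simp: linear_map_on_def V'_def)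
  moreover have "f v = 0" if "v \<in> V'" "\<And>i. i \<in> I \<Longrightarrow> F i v = 0" for v
    using that insert.prems(4) by (auto simp: V'_def)
  ultimately obtain c where c: "\<And>v. v \<in> V' \<Longrightarrow> f v = (\<Sum>i\<in>I. c i * F i v)"
    using insert.IH[OF sub] by blast
  show ?case
  proof (cases "\<exists>w\<in>V. F j w \<noteq> 0")
    case False
    then have "V' = V" by (auto simp: V'_def)
    with c False insert.hyps show ?thesis by (intro exI[of _ c]) auto
  next
    case True
    then obtain w where w: "w \<in> V" "F j w \<noteq> 0" by blast
    define d where "d = (f w - (\<Sum>i\<in>I. c i * F i w)) / F j w"
    have "f v = (\<Sum>i\<in>insert j I. (c(j := d)) i * F i v)" if v: "v \<in> V" for v
    proof -
      define r where "r = F j v / F j w"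
      have lin: "G (v + scale (- r) w) = G v - r * G w" if "linear_map_on V scale (*) G" for G
      proof -
        have "scale (- r) w \<in> V" by (rule subspace_scale[OF insert.prems(1) w(1)])
        then have "G (v + scale (- r) w) = G v + G (scale (- r) w)"
          using that v unfolding linear_map_on_def by blast
        also have "G (scale (- r) w) = - r * G w"
          using that w(1) unfolding linear_map_on_def by blast
        finally show ?thesis by simp
      qed
      have "v + scale (- r) w \<in> V"
        using v w(1) insert.prems(1) by (intro subspace_add subspace_scale)
      moreover have "F j (v + scale (- r) w) = 0"
        using lin[OF Fj] w(2) by (simp add: r_def)
      ultimately have "f (v + scale (- r) w) = (\<Sum>i\<in>I. c i * F i (v + scale (- r) w))"
        by (intro c) (simp add: V'_def)
      moreover have "(\<Sum>i\<in>I. c i * F i (v + scale (- r) w))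
          = (\<Sum>i\<in>I. c i * F i v) - r * (\<Sum>i\<in>I. c i * F i w)"
      proof -
        have "c i * F i (v + scale (- r) w) = c i * F i v - r * (c i * F i w)" if "i \<in> I" for i
        proof -
          have "F i (v + scale (- r) w) = F i v - r * F i w"
            using insert.prems(3)[of i] that by (intro lin) simp
          then show ?thesis by (simp only:) (simp add: algebra_simps)
        qed
        then show ?thesis by (simp add: sum_subtractf sum_distrib_left)
      qed
      ultimately have "f v - r * f w = (\<Sum>i\<in>I. c i * F i v) - r * (\<Sum>i\<in>I. c i * F i w)"
        using lin[OF insert.prems(2)] by argo
      then have "f v = (\<Sum>i\<in>I. c i * F i v) + r * (f w - (\<Sum>i\<in>I. c i * F i w))"
        by (simp add: algebra_simps)
      also have "r * (f w - (\<Sum>i\<in>I. c i * F i w)) = d * F j v"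
        by (simp add: r_def d_def)
      also have "(\<Sum>i\<in>I. c i * F i v) = (\<Sum>i\<in>I. (c(j := d)) i * F i v)"
        using insert.hyps by (intro sum.cong) auto
      finally show ?thesis using insert.hyps by simp
    qed
    then show ?thesis by blast
  qed
qed

end

section \<open>Generalized eigenspaces of an operator on a subspace\<close>

locale subspace_operator = vector_space scale
  for scale :: "'k::field \<Rightarrow> 'v::ab_group_add \<Rightarrow> 'v" (infixr "*s" 75) +
  fixes L S :: "'v set" and \<delta> :: "'v \<Rightarrow> 'v"
  assumes sub: "subspace L"
    and fin: "finite S" and L_span: "L \<subseteq> span S"
    and \<delta>_in [simp]: "x \<in> L \<Longrightarrow> \<delta> x \<in> L"
    and \<delta>_add: "x \<in> L \<Longrightarrow> y \<in> L \<Longrightarrow> \<delta> (x + y) = \<delta> x + \<delta> y"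
    and \<delta>_scale: "x \<in> L \<Longrightarrow> \<delta> (c *s x) = c *s \<delta> x"
begin

lemma L_closed [simp]:
  "0 \<in> L" "x \<in> L \<Longrightarrow> y \<in> L \<Longrightarrow> x + y \<in> L" "x \<in> L \<Longrightarrow> y \<in> L \<Longrightarrow> x - y \<in> L"
  "x \<in> L \<Longrightarrow> c *s x \<in> L"
  using sub by (auto simp: subspace_0 subspace_add subspace_diff subspace_scale)

lemma \<delta>_0 [simp]: "\<delta> 0 = 0"
  using \<delta>_scale[of 0 0] by simp

definition shift :: "'k \<Rightarrow> 'v \<Rightarrow> 'v" where
  "shift a x = \<delta> x - a *s x"

definition geig :: "'k \<Rightarrow> 'v set" where
  "geig a = {x \<in> L. \<exists>n. (shift a ^^ n) x = 0}"

text \<open>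
  The value at \<open>x\<close> of the product of the operators \<open>\<delta> - a\<close>, for \<open>a\<close> in the list. Lists of roots take
  the place of a minimal polynomial: the operators of two lists commute, so that the concatenation
  annihilates whatever one of the lists does.
\<close>

definition shifts :: "'k list \<Rightarrow> 'v \<Rightarrow> 'v" where
  "shifts as x = foldr shift as x"

definition poly_op :: "'k poly \<Rightarrow> 'v \<Rightarrow> 'v" where
  "poly_op p x = fold_coeffs (\<lambda>c y. c *s x + \<delta> y) p 0"

lemma shift_simps [simp]:
  "x \<in> L \<Longrightarrow> shift a x \<in> L"
  "shift a 0 = 0"
  by (simp_all add: shift_def)

lemma shift_add: "x \<in> L \<Longrightarrow> y \<in> L \<Longrightarrow> shift a (x + y) = shift a x + shift a y"
  by (simp add: shift_def \<delta>_add scale_right_distrib)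

lemma shift_scale: "x \<in> L \<Longrightarrow> shift a (c *s x) = c *s shift a x"
  by (simp add: shift_def \<delta>_scale scale_right_diff_distrib mult.commute)

lemma shift_diff: "x \<in> L \<Longrightarrow> y \<in> L \<Longrightarrow> shift a (x - y) = shift a x - shift a y"
  using shift_add[of "x - y" y a] by simp

lemma shift_commute: "x \<in> L \<Longrightarrow> shift a (shift b x) = shift b (shift a x)"
proof -
  assume x: "x \<in> L"
  have "shift a (shift b x) = shift a (\<delta> x) - b *s shift a x"
    using x by (simp add: shift_def[of b] shift_diff shift_scale)
  then show ?thesis
    using x \<delta>_add[of "\<delta> x - a *s x" "a *s x"] by (simp add: shift_def \<delta>_scale algebra_simps)
qed

lemma shifts_simps [simp]:
  "shifts [] x = x" "shifts (a # as) x = shift a (shifts as x)"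
  "shifts (as @ bs) x = shifts as (shifts bs x)"
  "x \<in> L \<Longrightarrow> shifts as x \<in> L" "shifts as 0 = 0"
proof -
  show "x \<in> L \<Longrightarrow> shifts as x \<in> L" by (induction as) (auto simp: shifts_def)
  show "shifts as 0 = 0" by (induction as) (auto simp: shifts_def)
qed (auto simp: shifts_def)

lemma shifts_add: "x \<in> L \<Longrightarrow> y \<in> L \<Longrightarrow> shifts as (x + y) = shifts as x + shifts as y"
  by (induction as) (auto simp: shift_add)

lemma shifts_scale: "x \<in> L \<Longrightarrow> shifts as (c *s x) = c *s shifts as x"
  by (induction as) (auto simp: shift_scale)

lemma shifts_shift: "x \<in> L \<Longrightarrow> shifts as (shift b x) = shift b (shifts as x)"
  by (induction as) (auto simp: shift_commute)

lemma shifts_commute: "x \<in> L \<Longrightarrow> shifts as (shifts bs x) = shifts bs (shifts as x)"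
  by (induction as) (auto simp: shifts_shift)

lemma poly_op_0 [simp]: "poly_op 0 x = 0"
  by (simp add: poly_op_def)

lemma poly_op_pCons [simp]: "poly_op (pCons a p) x = a *s x + \<delta> (poly_op p x)"
  by (cases "p = 0"; cases "a = 0") (auto simp: poly_op_def)

lemma poly_op_in [simp]: "x \<in> L \<Longrightarrow> poly_op p x \<in> L"
  by (induction p) auto

lemma poly_op_add: "x \<in> L \<Longrightarrow> poly_op (p + q) x = poly_op p x + poly_op q x"
  by (induction p q rule: poly_induct2) (auto simp: \<delta>_add algebra_simps)

lemma poly_op_smult: "x \<in> L \<Longrightarrow> poly_op (smult c p) x = c *s poly_op p x"
  by (induction p) (auto simp: \<delta>_scale algebra_simps)

lemma poly_op_monom: "poly_op (monom 1 n) x = (\<delta> ^^ n) x"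
  by (induction n) (auto simp: monom_Suc monom_0)

lemma poly_op_linear_factors:
  "x \<in> L \<Longrightarrow> \<exists>as. poly_op (\<Prod>a\<in>#A. [:-a, 1:]) x = shifts as x"
proof (induction A)
  case empty
  then show ?case by (intro exI[of _ "[]"]) (simp add: one_pCons)
next
  case (add a A)
  then obtain as where as: "poly_op (\<Prod>a\<in>#A. [:-a, 1:]) x = shifts as x" by blast
  let ?p = "\<Prod>a\<in>#A. [:-a, 1:]"
  have "poly_op (\<Prod>a\<in>#add_mset a A. [:-a, 1:]) x = poly_op (smult (-a) ?p + pCons 0 ?p) x"
    by simp
  also have "\<dots> = (-a) *s shifts as x + \<delta> (shifts as x)"
    using as add.prems by (simp only: poly_op_add poly_op_smult poly_op_pCons) simp
  also have "\<dots> = shifts (a # as) x" by (simp add: shift_def)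
  finally have "poly_op (\<Prod>a\<in>#add_mset a A. [:-a, 1:]) x = shifts (a # as) x" .
  then show ?case by blast
qed

lemma powers_in_range_poly_op:
  assumes "x \<in> L" "y \<in> span ((\<lambda>i. (\<delta> ^^ i) x) ` {..<n})"
  shows "\<exists>p. (\<forall>i\<ge>n. coeff p i = 0) \<and> y = poly_op p x"
  using assms(2)
proof (induction rule: span_induct_alt)
  case base
  show ?case by (intro exI[of _ 0]) simp
next
  case (step c z y)
  then obtain i p where i: "i < n" "z = (\<delta> ^^ i) x"
    and p: "\<forall>i\<ge>n. coeff p i = 0" "y = poly_op p x" by blast
  show ?case
  proof (intro exI conjI allI impI)
    show "coeff (smult c (monom 1 i) + p) j = 0" if "n \<le> j" for j
      using that i(1) p(1) by simp
    show "c *s z + y = poly_op (smult c (monom 1 i) + p) x"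
      using assms(1) i p by (simp add: poly_op_add poly_op_smult poly_op_monom)
  qed
qed

end

locale alg_closed_operator = subspace_operator scale L S \<delta>
  for scale :: "'k::alg_closed_field \<Rightarrow> 'v::ab_group_add \<Rightarrow> 'v" (infixr "*s" 75) and L S \<delta>
begin

text \<open>
  Some power of \<open>\<delta>\<close> sends \<open>x\<close> into the span of the earlier ones, so that a nonzero polynomial in \<open>\<delta>\<close>
  kills \<open>x\<close>, and over an algebraically closed field this polynomial is a product of linear factors.
\<close>

lemma shifts_annihilate_vector:
  assumes "x \<in> L"
  shows "\<exists>as. shifts as x = 0"
proof -
  have "(\<delta> ^^ n) x \<in> L" for n
    using assms by (induction n) auto
  then have "(\<delta> ^^ n) x \<in> span S" for n
    using L_span by auto
  then obtain n where "(\<delta> ^^ n) x \<in> span ((\<lambda>i. (\<delta> ^^ i) x) ` {..<n})"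
    using sequence_meets_earlier_span[OF fin, of "\<lambda>n. (\<delta> ^^ n) x"] by auto
  from powers_in_range_poly_op[OF assms this] obtain p
    where p: "coeff p n = 0" "(\<delta> ^^ n) x = poly_op p x" by blast
  define q where "q = monom 1 n + smult (- 1) p"
  have "coeff q n = 1" using p(1) by (simp add: q_def)
  then have "q \<noteq> 0" by auto
  have "poly_op q x = 0"
    using assms p(2) by (simp only: q_def poly_op_add poly_op_smult poly_op_monom) simp
  moreover obtain A where A: "q = smult (lead_coeff q) (\<Prod>a\<in>#A. [:-a, 1:])"
    using alg_closed_imp_factorization[OF \<open>q \<noteq> 0\<close>] by blast
  moreover obtain as where "poly_op (\<Prod>a\<in>#A. [:-a, 1:]) x = shifts as x"
    using poly_op_linear_factors[OF assms] by blast
  ultimately have "lead_coeff q *s shifts as x = 0"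
    using poly_op_smult[OF assms, of "lead_coeff q" "\<Prod>a\<in>#A. [:-a, 1:]"] by simp
  with \<open>q \<noteq> 0\<close> show ?thesis by (intro exI[of _ as]) simp
qed

lemma shifts_annihilate:
  "\<exists>as. \<forall>x\<in>L. shifts as x = 0"
proof -
  obtain b where b: "b \<subseteq> L" "independent b" "L \<subseteq> span b"
    using basis_exists by metis
  have "b \<subseteq> span S" using b(1) L_span by (rule subset_trans)
  then have "finite b" using independent_span_bound[OF fin b(2)] by simp
  then have "\<exists>as. \<forall>x\<in>b. shifts as x = 0" using b(1)
  proof (induction b)
    case (insert x b)
    then obtain as where as: "\<And>y. y \<in> b \<Longrightarrow> shifts as y = 0" by auto
    obtain bs where bs: "shifts bs x = 0"
      using shifts_annihilate_vector[of x] insert.prems by auto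
    have "shifts (bs @ as) y = 0" if "y \<in> insert x b" for y
      using that as bs insert.prems shifts_commute[of x bs as] by auto
    then show ?case by blast
  qed auto
  then obtain as where as: "\<And>x. x \<in> b \<Longrightarrow> shifts as x = 0" by blast
  have "x \<in> L \<and> shifts as x = 0" if "x \<in> span b" for x
    using that
  proof (induction rule: span_induct_alt)
    case (step c y z)
    then have "y \<in> L" "shifts as y = 0" using b(1) as by auto
    with step show ?case by (simp add: shifts_add shifts_scale)
  qed simp
  then show ?thesis using subsetD[OF b(3)] by (intro exI[of _ as]) simp
qed

lemma geigI: "x \<in> L \<Longrightarrow> (shift a ^^ n) x = 0 \<Longrightarrow> x \<in> geig a"
  by (auto simp: geig_def)

lemma geig_in: "x \<in> geig a \<Longrightarrow> x \<in> L"
  by (simp add: geig_def)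

lemma shift_pow_in [simp]: "x \<in> L \<Longrightarrow> (shift a ^^ n) x \<in> L"
  by (induction n) auto

lemma eigenvector_of_geig:
  assumes "x \<in> geig a" "x \<noteq> 0"
  obtains n where "(shift a ^^ n) x \<noteq> 0" "shift a ((shift a ^^ n) x) = 0"
proof -
  from assms have ex: "\<exists>n. (shift a ^^ n) x = 0" by (simp add: geig_def)
  define n where "n = (LEAST n. (shift a ^^ n) x = 0)"
  have n: "(shift a ^^ n) x = 0" unfolding n_def by (rule LeastI_ex[OF ex])
  then have "n \<noteq> 0" using assms(2) by (cases n) auto
  then obtain m where m: "n = Suc m" using not0_implies_Suc by blast
  have "(shift a ^^ m) x \<noteq> 0"
    using not_less_Least[of m "\<lambda>n. (shift a ^^ n) x = 0"] m by (simp add: n_def)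
  with n m show ?thesis by (intro that[of m]) auto
qed

text \<open>
  An eigenvector for \<open>a\<close> is multiplied by \<open>\<Prod>(a - b)\<close> under the product of the operators \<open>\<delta> - b\<close>;
  as a suitable such product vanishes on \<open>L\<close>, every eigenvalue is one of its finitely many roots.
\<close>

lemma finitely_many_geig:
  "\<exists>F. finite F \<and> (\<forall>a. a \<notin> F \<longrightarrow> geig a \<subseteq> {0})"
proof -
  obtain as where as: "\<forall>x\<in>L. shifts as x = 0" using shifts_annihilate by blast
  have "a \<in> set as" if x: "x \<in> geig a" "x \<noteq> 0" for a x
  proof (rule ccontr)
    assume a: "a \<notin> set as"
    obtain n where n: "(shift a ^^ n) x \<noteq> 0" "shift a ((shift a ^^ n) x) = 0"
      using eigenvector_of_geig[OF x] by blast
    define v where "v = (shift a ^^ n) x"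
    have v: "v \<in> L" "\<delta> v = a *s v" "v \<noteq> 0"
      using n geig_in[OF x(1)] by (auto simp: v_def shift_def)
    have "shifts bs v = (\<Prod>b\<leftarrow>bs. a - b) *s v" for bs
      by (induction bs) (auto simp: shift_scale v(1), simp add: shift_def v algebra_simps)
    with as v have "(\<Prod>b\<leftarrow>as. a - b) = 0" by (metis scale_eq_0_iff)
    with a show False by (auto simp: prod_list_zero_iff)
  qed
  then show ?thesis by (intro exI[of _ "set as"]) auto
qed

lemma subspace_geig: "subspace (geig a)"
proof -
  have z: "(shift a ^^ n) 0 = 0" for n by (induction n) auto
  have mono: "(shift a ^^ (m + n)) x = 0" if "(shift a ^^ n) x = 0" for m n x
    using that z by (simp add: funpow_add)
  have add: "(shift a ^^ n) (x + y) = (shift a ^^ n) x + (shift a ^^ n) y" if "x \<in> L" "y \<in> L" for n x y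
    using that by (induction n) (auto simp: shift_add)
  have scale: "(shift a ^^ n) (c *s x) = c *s (shift a ^^ n) x" if "x \<in> L" for n c x
    using that by (induction n) (auto simp: shift_scale)
  show ?thesis
  proof (rule subspaceI)
    fix x y assume "x \<in> geig a" "y \<in> geig a"
    then obtain m n where "x \<in> L" "y \<in> L" "(shift a ^^ m) x = 0" "(shift a ^^ n) y = 0"
      by (auto simp: geig_def)
    then have "(shift a ^^ (m + n)) (x + y) = 0"
      using mono[of n y m] mono[of m x n] by (simp add: add add.commute)
    with \<open>x \<in> L\<close> \<open>y \<in> L\<close> show "x + y \<in> geig a" unfolding geig_def by fastforce
  qed (auto simp: geig_def scale intro: exI[of _ 0])
qed

text \<open>
  On the generalized eigenspace of \<open>b\<close> the operator \<open>\<delta> - a\<close> is the nonzero scalar \<open>b - a\<close> plus the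
  nilpotent \<open>\<delta> - b\<close>, hence invertible. The induction sums the geometric series of its inverse.
\<close>

lemma geig_shift_preimage:
  assumes "y \<in> geig b" "b \<noteq> a"
  shows "\<exists>z\<in>geig b. shift a z = y"
proof -
  have "\<exists>z\<in>geig b. shift a z = y" if "(shift b ^^ n) y = 0" "y \<in> L" for n y
    using that
  proof (induction n arbitrary: y)
    case 0
    then show ?case using subspace_0[OF subspace_geig] by (intro bexI[of _ 0]) auto
  next
    case (Suc n)
    define w where "w = (1 / (b - a)) *s shift b y"
    have "(shift b ^^ n) (shift b y) = 0" using Suc.prems by (simp only: funpow_Suc_right o_apply)
    then obtain z' where z': "z' \<in> geig b" "shift a z' = shift b y"
      using Suc.IH Suc.prems by (metis shift_simps(1))
    define z where "z = (1 / (b - a)) *s (y - z')"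
    have "y \<in> geig b" using Suc.prems unfolding geig_def by blast
    then have "z \<in> geig b" using z'(1) unfolding z_def
      by (intro subspace_scale subspace_diff subspace_geig)
    moreover have "shift a z = (1 / (b - a)) *s (shift a y - shift b y)"
      using z' Suc.prems geig_in[OF z'(1)] by (simp add: z_def shift_scale shift_diff)
    moreover have "shift a y - shift b y = (b - a) *s y"
      by (simp add: shift_def algebra_simps)
    ultimately show ?case using assms(2) by (intro bexI[of _ z]) auto
  qed
  then show ?thesis using assms(1) by (auto simp: geig_def)
qed

text \<open>
  Write \<open>(\<delta> - a) x\<close> as a sum of generalized eigenvectors. Those for eigenvalues other than \<open>a\<close> have
  preimages under \<open>\<delta> - a\<close> of the same kind; after subtracting these from \<open>x\<close>, only a vector that
  \<open>\<delta> - a\<close> sends into the generalized eigenspace of \<open>a\<close> remains, and it lies there itself. Removing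
  the factors of an annihilating product one by one gives the spectral decomposition.
\<close>

lemma span_geig_shift:
  assumes "x \<in> L" "shift a x \<in> span (\<Union>b. geig b)"
  shows "x \<in> span (\<Union>b. geig b)"
proof -
  have inL: "y \<in> L" if "y \<in> span (\<Union>b. geig b)" for y
    using that by (induction rule: span_induct_alt) (auto simp: geig_in)
  have "\<exists>z. z \<in> span (\<Union>b. geig b) \<and> shift a z - y \<in> geig a" if "y \<in> span (\<Union>b. geig b)" for y
    using that
  proof (induction rule: span_induct_alt)
    case base
    show ?case using subspace_0[OF subspace_geig] span_zero by (intro exI[of _ 0]) simp
  next
    case (step c u y)
    then obtain z b where z: "z \<in> span (\<Union>b. geig b)" "shift a z - y \<in> geig a"
      and b: "u \<in> geig b" by blast
    have "\<exists>z'\<in>geig b. shift a z' - u \<in> geig a"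
    proof (cases "b = a")
      case True
      show ?thesis
        using b True subspace_neg[OF subspace_geig] subspace_0[OF subspace_geig]
        by (intro bexI[of _ 0]) auto
    next
      case False
      obtain z' where "z' \<in> geig b" "shift a z' = u"
        using geig_shift_preimage[OF b False] by auto
      then show ?thesis
        using subspace_0[OF subspace_geig, of a] by (intro bexI[of _ z']) simp_all
    qed
    then obtain z' where z': "z' \<in> geig b" "shift a z' - u \<in> geig a" by blast
    have "shift a (c *s z' + z) - (c *s u + y) = c *s (shift a z' - u) + (shift a z - y)"
      using geig_in[OF z'(1)] inL[OF z(1)]
      by (simp add: shift_add shift_scale algebra_simps)
    also have "\<dots> \<in> geig a"
      using z' z by (intro subspace_add subspace_scale subspace_geig)
    finally show ?case
      using z(1) z'(1) by (intro exI[of _ "c *s z' + z"]) (auto intro!: span_add span_scale intro: span_base)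
  qed
  from this[OF assms(2)] obtain z
    where z: "z \<in> span (\<Union>b. geig b)" "shift a z - shift a x \<in> geig a" by blast
  have "shift a (z - x) \<in> geig a"
    using z assms(1) inL by (simp add: shift_diff)
  then obtain n where "(shift a ^^ Suc n) (z - x) = 0"
    by (auto simp: geig_def funpow_Suc_right simp del: funpow.simps)
  then have "z - x \<in> geig a"
    using inL[OF z(1)] assms(1) by (intro geigI[where n = "Suc n"]) simp_all
  then have "z - x \<in> span (\<Union>b. geig b)" by (intro span_base) auto
  then have "z - (z - x) \<in> span (\<Union>b. geig b)"
    by (rule span_diff[OF z(1)])
  then show ?thesis by simp
qed

lemma L_subset_span_geig: "L \<subseteq> span (\<Union>a. geig a)"
proof
  fix x assume x: "x \<in> L"
  have "x \<in> span (\<Union>a. geig a)" if "shifts as x \<in> span (\<Union>a. geig a)" for as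
    using that
  proof (induction as)
    case (Cons a as)
    have "shifts as x \<in> span (\<Union>a. geig a)"
      using span_geig_shift[of "shifts as x" a] Cons.prems x by simp
    then show ?case by (rule Cons.IH)
  qed simp
  moreover obtain as where "shifts as x = 0" using shifts_annihilate_vector[OF x] by auto
  ultimately show "x \<in> span (\<Union>a. geig a)" using span_zero by metis
qed

end

section \<open>Lie algebras with an injective derivation\<close>

locale lie_algebra_with_derivation = alg_closed_operator scale L S \<delta>
  for scale :: "'k::{alg_closed_field, field_char_0} \<Rightarrow> 'v::ab_group_add \<Rightarrow> 'v" (infixr "*s" 75)
    and L S \<delta> +
  fixes br :: "'v \<Rightarrow> 'v \<Rightarrow> 'v"
  assumes br_in [simp]: "x \<in> L \<Longrightarrow> y \<in> L \<Longrightarrow> br x y \<in> L"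
    and br_add: "x \<in> L \<Longrightarrow> y \<in> L \<Longrightarrow> z \<in> L \<Longrightarrow> br x (y + z) = br x y + br x z"
    and br_scale: "x \<in> L \<Longrightarrow> y \<in> L \<Longrightarrow> br x (c *s y) = c *s br x y"
    and br_anti: "x \<in> L \<Longrightarrow> y \<in> L \<Longrightarrow> br x y = - br y x"
    and br_jacobi: "x \<in> L \<Longrightarrow> y \<in> L \<Longrightarrow> z \<in> L \<Longrightarrow> br x (br y z) = br (br x y) z + br y (br x z)"
    and derivation: "x \<in> L \<Longrightarrow> y \<in> L \<Longrightarrow> \<delta> (br x y) = br (\<delta> x) y + br x (\<delta> y)"
    and injective: "x \<in> L \<Longrightarrow> \<delta> x = 0 \<Longrightarrow> x = 0"
begin

lemma br_0 [simp]: "x \<in> L \<Longrightarrow> br x 0 = 0" "x \<in> L \<Longrightarrow> br 0 x = 0"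
  using br_scale[of x 0 0] br_anti[of 0 x] by auto

lemma br_diff: "x \<in> L \<Longrightarrow> y \<in> L \<Longrightarrow> z \<in> L \<Longrightarrow> br x (y - z) = br x y - br x z"
  using br_add[of x "y - z" z] by simp

lemma br_linear_left:
  assumes "x \<in> L" "y \<in> L" "z \<in> L"
  shows "br (x + y) z = br x z + br y z" "br (x - y) z = br x z - br y z" "br (c *s x) z = c *s br x z"
proof -
  have flip: "u \<in> L \<Longrightarrow> br u z = - br z u" for u using assms(3) by (intro br_anti)
  show "br (x + y) z = br x z + br y z" "br (x - y) z = br x z - br y z" "br (c *s x) z = c *s br x z"
    using assms flip[of "x + y"] flip[of "x - y"] flip[of "c *s x"] flip[of x] flip[of y]
    by (simp_all add: br_add br_scale br_diff)
qed

lemma br_self [simp]: "x \<in> L \<Longrightarrow> br x x = 0"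
proof -
  assume "x \<in> L"
  then have "br x x = - br x x" by (intro br_anti)
  then have "br x x + br x x = 0" by (metis add.left_inverse)
  then have "(1 + 1) *s br x x = 0" by (simp only: scale_left_distrib scale_one)
  then show ?thesis by simp
qed

lemma br_span_right:
  assumes "x \<in> L" "T \<subseteq> L" "subspace U" "\<And>t. t \<in> T \<Longrightarrow> br x t \<in> U" "t \<in> span T"
  shows "br x t \<in> U"
proof -
  have "t \<in> L \<and> br x t \<in> U"
    using assms(5)
  proof (induction rule: span_induct_alt)
    case base
    then show ?case using assms(1,3) by (simp add: subspace_0)
  next
    case (step c y z)
    have "y \<in> L" using step(1) assms(2) by blast
    then have "br x (c *s y + z) = c *s br x y + br x z"
      using assms(1) step(2) by (simp add: br_add br_scale)
    with assms(3) assms(4)[OF step(1)] step(2) \<open>y \<in> L\<close> show ?case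
      by (simp add: subspace_add subspace_scale)
  qed
  then show ?thesis ..
qed

lemma br_span_left:
  assumes "A \<subseteq> L" "t \<in> L" "subspace U" "\<And>x. x \<in> A \<Longrightarrow> br x t \<in> U" "x \<in> span A"
  shows "br x t \<in> U"
proof -
  have x: "x \<in> L" using assms(1,5) span_minimal[OF _ sub] by blast
  have "br t y \<in> U" if "y \<in> A" for y
  proof -
    have "y \<in> L" using that assms(1) by blast
    then have "br t y = - br y t" using assms(2) by (intro br_anti)
    then show ?thesis using subspace_neg[OF assms(3) assms(4)[OF that]] by simp
  qed
  then have "br t x \<in> U"
    using br_span_right[OF assms(2,1,3) _ assms(5)] by blast
  then show ?thesis
    using br_anti[OF x assms(2)] subspace_neg[OF assms(3)] by simp
qed

text \<open>
  The usual proof of Engel's theorem enlarges a maximal proper subalgebra \<open>B\<close> by an element \<open>s\<close>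
  that normalizes it, which is found by applying the induction hypothesis to the action of \<open>B\<close> on
  the whole algebra modulo \<open>B\<close>. Here \<open>A\<close> is only a bracket-closed set of ad-nilpotent elements, and
  \<open>s\<close> must again lie in it, as sums of ad-nilpotent elements are not known to be ad-nilpotent. For
  this reason the vector killed modulo \<open>U\<close> is asserted to lie in an invariant set \<open>T\<close>, of which \<open>A\<close>
  itself is an instance.
\<close>

lemma weakly_closed_Engel:
  assumes "A \<subseteq> L" "\<And>x y. x \<in> A \<Longrightarrow> y \<in> A \<Longrightarrow> br x y \<in> A"
    and "\<And>x y. x \<in> A \<Longrightarrow> y \<in> L \<Longrightarrow> \<exists>n. (br x ^^ n) y = 0"
    and "subspace U" "U \<subseteq> L" "\<And>x u. x \<in> A \<Longrightarrow> u \<in> U \<Longrightarrow> br x u \<in> U"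
    and "T \<subseteq> L" "\<And>x t. x \<in> A \<Longrightarrow> t \<in> T \<Longrightarrow> br x t \<in> T"
    and "\<not> T \<subseteq> U"
  shows "\<exists>v\<in>T - U. \<forall>x\<in>A. br x v \<in> U"
  using assms
proof (induction "dim A" arbitrary: A U T rule: less_induct)
  case less
  note A = less.prems(1-3) and U = less.prems(4-6) and T = less.prems(7-9)
  show ?case
  proof (cases "A \<subseteq> {0}")
    case True
    obtain v where "v \<in> T - U" using T(3) by blast
    moreover have "br x v \<in> U" if "x \<in> A" for x
    proof -
      have "x = 0" "v \<in> L" using that True \<open>v \<in> T - U\<close> T(1) by auto
      then show ?thesis using subspace_0[OF U(1)] by simp
    qed
    ultimately show ?thesis by blast
  next
    case False
    \<comment> \<open>The bracket-closed parts of \<open>A\<close> of smaller dimension, as subsets of \<open>A\<close> with smaller span.\<close>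
    define P where "P B \<longleftrightarrow> B \<subseteq> A \<and> (\<forall>x\<in>B. \<forall>y\<in>B. br x y \<in> B) \<and> \<not> A \<subseteq> span B" for B
    have A_span: "A \<subseteq> span S" using A(1) L_span by blast
    have P_dim: "dim B < dim A" if "P B" for B
    proof -
      obtain a where "a \<in> A" "a \<notin> span B" using \<open>P B\<close> by (auto simp: P_def)
      moreover have "B \<subseteq> span A" using \<open>P B\<close> span_superset by (auto simp: P_def)
      ultimately show ?thesis
        using dim_less_of_proper_span[OF fin A_span] span_base by blast
    qed
    have "P {}" using False by (simp add: P_def)
    then obtain B where B: "P B" and max: "\<And>C. P C \<Longrightarrow> dim C \<le> dim B"
      using ex_has_greatest_nat[of P "{}" dim "dim A"] P_dim by (meson less_imp_le)
    have BA: "B \<subseteq> A" and B_closed: "\<And>x y. x \<in> B \<Longrightarrow> y \<in> B \<Longrightarrow> br x y \<in> B"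
      using B by (auto simp: P_def)
    have BL: "B \<subseteq> L" using BA A(1) by blast
    \<comment> \<open>Induction hypothesis for \<open>B\<close> acting on \<open>A\<close> modulo \<open>span B\<close>: some \<open>s\<close> normalizes \<open>span B\<close>.\<close>
    have "\<exists>s\<in>A - span B. \<forall>x\<in>B. br x s \<in> span B"
    proof (rule less.hyps[OF P_dim[OF B]])
      show "span B \<subseteq> L" using BL span_minimal[OF _ sub] by blast
      show "br x u \<in> span B" if "x \<in> B" "u \<in> span B" for x u
        using that BL B_closed by (intro br_span_right[of x B "span B" u]) (auto intro: span_base)
      show "\<not> A \<subseteq> span B" using B by (simp add: P_def)
    qed (use A BA BL B_closed in auto)
    then obtain s where s: "s \<in> A" "s \<notin> span B" and Bs: "\<And>x. x \<in> B \<Longrightarrow> br x s \<in> span B"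
      by blast
    have sL: "s \<in> L" using s(1) A(1) by blast
    define C where "C = A \<inter> span (insert s B)"
    have iBL: "insert s B \<subseteq> L" using BL sL by simp
    have ins: "br x y \<in> span (insert s B)" if "x \<in> insert s B" "y \<in> insert s B" for x y
    proof -
      have sB: "br s z \<in> span B" if "z \<in> B" for z
        using Bs[OF that] br_anti[OF sL, of z] that BL span_neg by (metis subsetD)
      have "br x y \<in> span B"
        using that(1)
      proof
        assume "x = s"
        with that(2) sB sL show ?thesis by (auto simp: span_zero)
      next
        assume "x \<in> B"
        with that(2) Bs B_closed span_base show ?thesis by blast
      qed
      then show ?thesis using span_mono[of B "insert s B"] by blast
    qed
    have C_closed: "br x y \<in> C" if "x \<in> C" "y \<in> C" for x y
    proof -
      have xy: "x \<in> A" "y \<in> A" "x \<in> span (insert s B)" "y \<in> span (insert s B)"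
        using that by (auto simp: C_def)
      then have "x \<in> L" "y \<in> L" using A(1) by auto
      have "br z y \<in> span (insert s B)" if "z \<in> insert s B" for z
        using br_span_right[OF _ iBL subspace_span ins[OF that] xy(4)] iBL that by blast
      then have "br x y \<in> span (insert s B)"
        using br_span_left[OF iBL \<open>y \<in> L\<close> subspace_span _ xy(3)] by blast
      then show ?thesis using xy A(2) by (simp add: C_def)
    qed
    \<comment> \<open>Otherwise \<open>C\<close> would be a larger proper bracket-closed part than the maximal \<open>B\<close>.\<close>
    have A_span_sB: "A \<subseteq> span (insert s B)"
    proof (rule ccontr)
      assume "\<not> A \<subseteq> span (insert s B)"
      moreover have "span C \<subseteq> span (insert s B)"
        by (rule span_minimal) (auto simp: C_def)
      ultimately have "P C" using C_closed by (auto simp: P_def C_def)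
      moreover have "dim B < dim C"
      proof (rule dim_less_of_proper_span[OF fin])
        show "C \<subseteq> span S" using A_span by (auto simp: C_def)
        show "B \<subseteq> span C" using BA by (auto simp: C_def intro!: span_base)
        show "s \<in> span C" using s(1) by (auto simp: C_def intro!: span_base)
      qed (fact s(2))
      ultimately show False using max by fastforce
    qed
    have "\<exists>v\<in>T - U. \<forall>x\<in>B. br x v \<in> U"
      by (rule less.hyps[OF P_dim[OF B]]) (use A U T BA BL B_closed in auto)
    then obtain v0 where v0: "v0 \<in> T" "v0 \<notin> U" "\<And>x. x \<in> B \<Longrightarrow> br x v0 \<in> U" by blast
    \<comment> \<open>Since \<open>s\<close> normalizes \<open>span B\<close>, it preserves the vectors killed by \<open>B\<close> modulo \<open>U\<close>; the last vector of
       the orbit outside \<open>U\<close> is therefore killed by \<open>B\<close> and by \<open>s\<close>.\<close>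
    have orbit: "(br s ^^ n) v0 \<in> T \<and> (\<forall>x\<in>B. br x ((br s ^^ n) v0) \<in> U)" for n
    proof (induction n)
      case 0
      then show ?case using v0 by simp
    next
      case (Suc n)
      define w where "w = (br s ^^ n) v0"
      have w: "w \<in> T" "\<And>x. x \<in> B \<Longrightarrow> br x w \<in> U" using Suc by (auto simp: w_def)
      then have "w \<in> L" using T(1) by blast
      have "br x (br s w) \<in> U" if "x \<in> B" for x
      proof -
        have "x \<in> L" using that BL by blast
        have "br (br x s) w \<in> U"
          using br_span_left[OF BL \<open>w \<in> L\<close> U(1) w(2) Bs[OF that]] .
        moreover have "br s (br x w) \<in> U" using w(2)[OF that] U(3) s(1) by blast
        ultimately show ?thesis
          using br_jacobi[OF \<open>x \<in> L\<close> sL \<open>w \<in> L\<close>] subspace_add[OF U(1)] by simp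
      qed
      with w(1) s(1) T(2) show ?case by (simp add: w_def)
    qed
    have v0L: "v0 \<in> L" using v0(1) T(1) by blast
    have ex: "\<exists>n. (br s ^^ n) v0 \<in> U"
    proof -
      obtain n where "(br s ^^ n) v0 = 0" using A(3)[OF s(1) v0L] by blast
      then show ?thesis using subspace_0[OF U(1)] by (intro exI[of _ n]) simp
    qed
    define n where "n = (LEAST n. (br s ^^ n) v0 \<in> U)"
    have n: "(br s ^^ n) v0 \<in> U" unfolding n_def by (rule LeastI_ex[OF ex])
    with v0(2) have "n \<noteq> 0" by (cases n) auto
    then obtain m where m: "n = Suc m" using not0_implies_Suc by blast
    define v where "v = (br s ^^ m) v0"
    have "v \<notin> U"
      using not_less_Least[of m "\<lambda>n. (br s ^^ n) v0 \<in> U"] m by (simp add: n_def v_def)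
    moreover have v: "v \<in> T" "\<And>x. x \<in> insert s B \<Longrightarrow> br x v \<in> U"
      using orbit[of m] n m by (auto simp: v_def)
    moreover have "br x v \<in> U" if "x \<in> A" for x
      using br_span_left[OF iBL _ U(1) v(2)] A_span_sB that v(1) T(1) by blast
    ultimately show ?thesis by blast
  qed
qed

text \<open>
  Because \<open>(\<delta> - a - b) [x, y] = [(\<delta> - a) x, y] + [x, (\<delta> - b) y]\<close>, one applies induction on the sum of
  the orders at which \<open>x\<close> and \<open>y\<close> are killed.
\<close>

lemma geig_br:
  assumes "x \<in> geig a" "y \<in> geig b"
  shows "br x y \<in> geig (a + b)"
proof -
  have "br x y \<in> geig (a + b)"
    if "x \<in> L" "y \<in> L" "(shift a ^^ m) x = 0" "(shift b ^^ n) y = 0" for m n x y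
    using that
  proof (induction "m + n" arbitrary: m n x y)
    case 0
    then show ?case using subspace_0[OF subspace_geig] by simp
  next
    case (Suc k)
    have z: "(shift c ^^ n) 0 = 0" for n c by (induction n) auto
    have "br (shift a x) y \<in> geig (a + b)"
    proof (cases m)
      case 0
      then show ?thesis using Suc.prems subspace_0[OF subspace_geig] by simp
    next
      case (Suc m')
      have "(shift a ^^ m') (shift a x) = 0"
        using Suc.prems(3) by (simp only: Suc funpow_Suc_right o_apply)
      then show ?thesis
        using Suc.hyps(1)[of m' n "shift a x" y] Suc.hyps(2) Suc Suc.prems by simp
    qed
    moreover have "br x (shift b y) \<in> geig (a + b)"
    proof (cases n)
      case 0
      then show ?thesis using Suc.prems subspace_0[OF subspace_geig] by simp
    next
      case (Suc n')
      have "(shift b ^^ n') (shift b y) = 0"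
        using Suc.prems(4) by (simp only: Suc funpow_Suc_right o_apply)
      then show ?thesis
        using Suc.hyps(1)[of m n' x "shift b y"] Suc.hyps(2) Suc Suc.prems by simp
    qed
    moreover have "shift (a + b) (br x y) = br (shift a x) y + br x (shift b y)"
      using Suc.prems(1,2)
      by (simp add: shift_def derivation br_linear_left br_diff br_scale scale_left_distrib)
    ultimately have "shift (a + b) (br x y) \<in> geig (a + b)"
      using subspace_add[OF subspace_geig] by simp
    then obtain j where "(shift (a + b) ^^ Suc j) (br x y) = 0"
      by (auto simp: geig_def funpow_Suc_right simp del: funpow.simps)
    with Suc.prems(1,2) show ?case by (intro geigI[where n = "Suc j"]) simp_all
  qed
  then show ?thesis using assms by (auto simp: geig_def)
qed

text \<open>
  For \<open>x\<close> in the generalized eigenspace of \<open>a\<close>, the operator \<open>ad x\<close> moves that of \<open>b\<close> through those of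
  \<open>b + a\<close>, \<open>b + 2 a\<close>, and so on. These values are distinct, as \<open>a \<noteq> 0\<close> in characteristic zero, and
  only finitely many of them are eigenvalues.
\<close>

lemma br_geig_nilpotent:
  assumes "x \<in> geig a" "y \<in> L"
  shows "\<exists>n. (br x ^^ n) y = 0"
proof -
  have xL: "x \<in> L" using assms(1) by (rule geig_in)
  have z: "(br x ^^ n) 0 = 0" for n using xL by (induction n) auto
  have inL: "(br x ^^ n) u \<in> L" if "u \<in> L" for n u using that xL by (induction n) auto
  have add: "(br x ^^ n) (c *s u + w) = c *s (br x ^^ n) u + (br x ^^ n) w" if "u \<in> L" "w \<in> L" for n c u w
    using that xL inL by (induction n) (auto simp: br_add br_scale)
  have mono: "(br x ^^ (m + n)) u = 0" if "(br x ^^ n) u = 0" for m n u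
    using that z by (simp add: funpow_add)
  have nil: "\<exists>n. (br x ^^ n) u = 0" if u: "u \<in> geig b" for u b
  proof (cases "x = 0")
    case True
    with geig_in[OF u] show ?thesis by (intro exI[of _ 1]) simp
  next
    case False
    have "a \<noteq> 0"
    proof
      assume "a = 0"
      from eigenvector_of_geig[OF assms(1) False] obtain n
        where "(shift a ^^ n) x \<noteq> 0" "shift a ((shift a ^^ n) x) = 0" by blast
      with \<open>a = 0\<close> injective[of "(shift a ^^ n) x"] xL show False
        by (simp add: shift_def)
    qed
    obtain F where F: "finite F" "\<And>c. c \<notin> F \<Longrightarrow> geig c \<subseteq> {0}"
      using finitely_many_geig by blast
    have "inj (\<lambda>n. of_nat n * a + b)" using \<open>a \<noteq> 0\<close> by (auto intro: injI)
    then have "\<not> finite (range (\<lambda>n. of_nat n * a + b))"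
      using finite_imageD[of "\<lambda>n. of_nat n * a + b" UNIV] infinite_UNIV_nat by auto
    then have "\<not> range (\<lambda>n. of_nat n * a + b) \<subseteq> F"
      using F(1) finite_subset by metis
    then obtain n where "of_nat n * a + b \<notin> F" by auto
    moreover have "(br x ^^ n) u \<in> geig (of_nat n * a + b)"
    proof (induction n)
      case (Suc n)
      have "of_nat (Suc n) * a + b = a + (of_nat n * a + b)" by (simp add: algebra_simps)
      then show ?case using geig_br[OF assms(1) Suc] by (simp only: funpow.simps o_apply)
    qed (use u in simp)
    ultimately show ?thesis using F(2) by blast
  qed
  have "y \<in> L \<and> (\<exists>n. (br x ^^ n) y = 0)" if "y \<in> span (\<Union>b. geig b)" for y
    using that
  proof (induction rule: span_induct_alt)
    case base
    show ?case by (auto intro: exI[of _ 0])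
  next
    case (step c u w)
    then obtain m n where mn: "(br x ^^ m) u = 0" "(br x ^^ n) w = 0" using nil by blast
    have "u \<in> L" "w \<in> L" using step geig_in by auto
    then have "(br x ^^ (m + n)) (c *s u + w) = 0"
      using mono[OF mn(2), of m] mono[OF mn(1), of n] add by (simp add: add.commute)
    with \<open>u \<in> L\<close> \<open>w \<in> L\<close> show ?case by auto
  qed
  then show ?thesis using subsetD[OF L_subset_span_geig assms(2)] by simp
qed

text \<open>
  Jacobson's theorem that an invertible derivation forces nilpotency, in the weak form that the
  centre is nonzero. The central vector that Engel's theorem gives is a generalized eigenvector; the
  last nonzero power of \<open>\<delta> - a\<close> applied to it is an eigenvector and still central.
\<close>

theorem central_eigenvector:
  assumes "L \<noteq> {0}"
  shows "\<exists>v\<in>L. \<exists>l. v \<noteq> 0 \<and> \<delta> v = l *s v \<and> (\<forall>x\<in>L. br x v = 0)"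
proof -
  let ?H = "\<Union>a. geig a"
  have HL: "?H \<subseteq> L" using geig_in by blast
  have "\<not> ?H \<subseteq> {0}"
  proof
    assume "?H \<subseteq> {0}"
    then have "span ?H \<subseteq> {0}" by (intro span_minimal subspace_single_0)
    with L_subset_span_geig assms L_closed(1) show False by blast
  qed
  moreover have "br x y \<in> ?H" if "x \<in> ?H" "y \<in> ?H" for x y
    using that geig_br by blast
  moreover have "\<exists>n. (br x ^^ n) y = 0" if "x \<in> ?H" "y \<in> L" for x y
    using that br_geig_nilpotent by blast
  moreover have "br x u \<in> {0}" if "x \<in> ?H" "u \<in> {0}" for x u
    using that geig_in by auto
  ultimately have "\<exists>v\<in>?H - {0}. \<forall>x\<in>?H. br x v \<in> {0}"
    using HL weakly_closed_Engel[of ?H "{0}" ?H] by simp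
  then obtain v a where v: "v \<in> geig a" "v \<noteq> 0" "\<And>x. x \<in> ?H \<Longrightarrow> br x v = 0" by blast
  have vL: "v \<in> L" using v(1) by (rule geig_in)
  have central: "br x v = 0" if "x \<in> L" for x
    using br_span_left[OF HL vL subspace_single_0, of x] v(3) subsetD[OF L_subset_span_geig that]
    by simp
  have "\<forall>x\<in>L. br x ((shift a ^^ n) v) = 0" for n
  proof (induction n)
    case (Suc n)
    define w where "w = (shift a ^^ n) v"
    have "w \<in> L" "\<forall>x\<in>L. br x w = 0" using vL Suc by (auto simp: w_def)
    then have "br x (\<delta> w) = 0" if "x \<in> L" for x
      using derivation[of x w] that by simp
    with \<open>w \<in> L\<close> \<open>\<forall>x\<in>L. br x w = 0\<close> have "\<forall>x\<in>L. br x (shift a w) = 0"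
      by (simp add: shift_def br_diff br_scale)
    then show ?case by (simp add: w_def)
  qed (use central in simp)
  moreover obtain n where n: "(shift a ^^ n) v \<noteq> 0" "shift a ((shift a ^^ n) v) = 0"
    using eigenvector_of_geig[OF v(1,2)] by blast
  ultimately show ?thesis
    using vL by (intro bexI[of _ "(shift a ^^ n) v"] exI[of _ a]) (auto simp: shift_def)
qed

end

section \<open>Odd-quadratic odd-symplectic Lie superalgebras\<close>

lemma bit_cases: "(\<alpha> :: bit) = 0 \<or> \<alpha> = 1"
  by (cases \<alpha>) auto

lemma ksign_simps [simp]:
  "ksign 0 \<alpha> = 1" "ksign \<alpha> 0 = 1" "ksign 1 1 = - 1"
  by (simp_all add: ksign_def)

lemma ksign_commute: "ksign \<alpha> \<beta> = ksign \<beta> \<alpha>"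
  by (auto simp: ksign_def)

locale odd_quadratic_odd_symplectic_algebra =
  fixes g :: "('k::field, 'v::ab_group_add) superalgebra_forms"
  assumes odd_quadratic_odd_symplectic: "odd_quadratic_odd_symplectic g"
begin

abbreviation "V \<equiv> carr g"
abbreviation sc (infixr "*s" 75) where "sc \<equiv> scl g"
abbreviation "br \<equiv> brk g"
abbreviation "B \<equiv> Bform g"
abbreviation "\<omega> \<equiv> symp g"

lemma lie: "lie_superalgebra g"
  and scalar_product: "odd_invariant_scalar_product g B"
  and symplectic: "odd_symplectic_form g \<omega>"
  using odd_quadratic_odd_symplectic by (auto simp: odd_quadratic_odd_symplectic_def)

sublocale vector_space "scl g"
  using lie unfolding lie_superalgebra_def by blast

lemma subspace_hpart: "subspace (hpart g \<alpha>)"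
  using lie unfolding lie_superalgebra_def by blast

lemma hpart_closed [simp]:
  "0 \<in> hpart g \<alpha>" "X \<in> hpart g \<alpha> \<Longrightarrow> Y \<in> hpart g \<alpha> \<Longrightarrow> X + Y \<in> hpart g \<alpha>"
  "X \<in> hpart g \<alpha> \<Longrightarrow> Y \<in> hpart g \<alpha> \<Longrightarrow> X - Y \<in> hpart g \<alpha>"
  "X \<in> hpart g \<alpha> \<Longrightarrow> - X \<in> hpart g \<alpha>" "X \<in> hpart g \<alpha> \<Longrightarrow> c *s X \<in> hpart g \<alpha>"
  using subspace_hpart
  by (auto simp: subspace_0 subspace_add subspace_diff subspace_neg subspace_scale)

lemma hpart_disjoint: "X \<in> hpart g 0 \<Longrightarrow> X \<in> hpart g 1 \<Longrightarrow> X = 0"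
  using lie unfolding lie_superalgebra_def by blast

lemma decompose:
  assumes "X \<in> V"
  obtains X0 X1 where "X = X0 + X1" "X0 \<in> hpart g 0" "X1 \<in> hpart g 1"
  using assms by (auto simp: carr_def)

lemma hpart_carr [simp]: "X \<in> hpart g \<alpha> \<Longrightarrow> X \<in> V"
proof -
  assume X: "X \<in> hpart g \<alpha>"
  have "X + 0 \<in> V" if "\<alpha> = 0" using X that hpart_closed(1)[of 1] unfolding carr_def by blast
  moreover have "0 + X \<in> V" if "\<alpha> = 1" using X that hpart_closed(1)[of 0] unfolding carr_def by blast
  ultimately show ?thesis using bit_cases[of \<alpha>] by auto
qed

lemma subspace_carr: "subspace V"
  unfolding carr_def by (rule subspace_sums[OF subspace_hpart subspace_hpart])

lemma carr_closed [simp]: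
  "0 \<in> V" "X \<in> V \<Longrightarrow> Y \<in> V \<Longrightarrow> X + Y \<in> V" "X \<in> V \<Longrightarrow> Y \<in> V \<Longrightarrow> X - Y \<in> V"
  "X \<in> V \<Longrightarrow> - X \<in> V" "X \<in> V \<Longrightarrow> c *s X \<in> V"
  using subspace_carr
  by (auto simp: subspace_0 subspace_add subspace_diff subspace_neg subspace_scale)

lemma finite_span: "\<exists>S. finite S \<and> V \<subseteq> span S"
  using lie unfolding lie_superalgebra_def by blast

lemma br_bilinear [simp]:
  assumes "X \<in> V" "Y \<in> V"
  shows "Z \<in> V \<Longrightarrow> br X (Y + Z) = br X Y + br X Z" "br X (c *s Y) = c *s br X Y"
    "Z \<in> V \<Longrightarrow> br (X + Z) Y = br X Y + br Z Y" "br (c *s X) Y = c *s br X Y"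
proof -
  have "bilinear_map_on V (*s) (*s) br" using lie unfolding lie_superalgebra_def by blast
  with assms show "Z \<in> V \<Longrightarrow> br X (Y + Z) = br X Y + br X Z" "br X (c *s Y) = c *s br X Y"
    "Z \<in> V \<Longrightarrow> br (X + Z) Y = br X Y + br Z Y" "br (c *s X) Y = c *s br X Y"
    unfolding bilinear_map_on_def linear_map_on_def by blast+
qed

lemma br_hpart: "X \<in> hpart g \<alpha> \<Longrightarrow> Y \<in> hpart g \<beta> \<Longrightarrow> br X Y \<in> hpart g (\<alpha> + \<beta>)"
  using lie unfolding lie_superalgebra_def by blast

lemma br_in [simp]: "X \<in> V \<Longrightarrow> Y \<in> V \<Longrightarrow> br X Y \<in> V"
proof -
  assume "X \<in> V" "Y \<in> V"
  then obtain X0 X1 Y0 Y1 where "X = X0 + X1" "X0 \<in> hpart g 0" "X1 \<in> hpart g 1"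
    "Y = Y0 + Y1" "Y0 \<in> hpart g 0" "Y1 \<in> hpart g 1"
    using decompose[of X] decompose[of Y] by metis
  moreover from this have "br X0 Y0 \<in> V" "br X0 Y1 \<in> V" "br X1 Y0 \<in> V" "br X1 Y1 \<in> V"
    by (auto intro: hpart_carr br_hpart)
  ultimately show ?thesis by simp
qed

lemma br_zero [simp]: "X \<in> V \<Longrightarrow> br X 0 = 0" "X \<in> V \<Longrightarrow> br 0 X = 0"
  using br_bilinear(2)[of X 0 0] br_bilinear(4)[of 0 X 0] by auto

lemma br_minus [simp]:
  assumes "X \<in> V" "Y \<in> V"
  shows "br X (- Y) = - br X Y" "br (- X) Y = - br X Y"
    "Z \<in> V \<Longrightarrow> br X (Y - Z) = br X Y - br X Z" "Z \<in> V \<Longrightarrow> br (X - Z) Y = br X Y - br Z Y"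
proof -
  show m: "br X (- Y) = - br X Y" "br (- X) Y = - br X Y"
    using br_bilinear(2)[OF assms, of "-1"] br_bilinear(4)[OF assms, of "-1"] by simp_all
  show "br X (Y - Z) = br X Y - br X Z" if "Z \<in> V"
    using assms that br_bilinear(1)[of X "Y - Z" Z] by simp
  show "br (X - Z) Y = br X Y - br Z Y" if "Z \<in> V"
    using assms that br_bilinear(3)[of "X - Z" Y Z] by simp
qed

lemma br_swap:
  "X \<in> hpart g \<alpha> \<Longrightarrow> Y \<in> hpart g \<beta> \<Longrightarrow> br X Y = - (ksign \<alpha> \<beta> *s br Y X)"
  using lie unfolding lie_superalgebra_def by blast

text \<open>
  The cyclic identity of the definition rewritten with \<open>br_swap\<close>: \<open>ad X\<close> is a superderivation.
\<close>

lemma jacobi_hpart: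
  assumes X: "X \<in> hpart g \<alpha>" and Y: "Y \<in> hpart g \<beta>" and Z: "Z \<in> hpart g \<gamma>"
  shows "br X (br Y Z) = br (br X Y) Z + ksign \<alpha> \<beta> *s br Y (br X Z)"
proof -
  have J: "ksign \<alpha> \<gamma> *s br X (br Y Z) + ksign \<beta> \<alpha> *s br Y (br Z X)
      + ksign \<gamma> \<beta> *s br Z (br X Y) = 0"
    using lie X Y Z unfolding lie_superalgebra_def by blast
  have 1: "br Z X = - (ksign \<gamma> \<alpha> *s br X Z)" using br_swap[OF Z X] .
  have 2: "br Z (br X Y) = - (ksign \<gamma> (\<alpha> + \<beta>) *s br (br X Y) Z)"
    using br_swap[OF Z br_hpart[OF X Y]] .
  have V: "X \<in> V" "Y \<in> V" "Z \<in> V" using X Y Z by auto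
  show ?thesis
    using bit_cases[of \<alpha>] bit_cases[of \<beta>] bit_cases[of \<gamma>] J V unfolding 1 2
    by (elim disjE) (simp_all add: algebra_simps eq_neg_iff_add_eq_0)
qed

lemma jacobi:
  assumes X: "X \<in> hpart g \<alpha>" and Y: "Y \<in> hpart g \<beta>" and "Z \<in> V"
  shows "br X (br Y Z) = br (br X Y) Z + ksign \<alpha> \<beta> *s br Y (br X Z)"
proof -
  obtain Z0 Z1 where Z: "Z = Z0 + Z1" "Z0 \<in> hpart g 0" "Z1 \<in> hpart g 1"
    using decompose[OF \<open>Z \<in> V\<close>] .
  have "X \<in> V" "Y \<in> V" "Z0 \<in> V" "Z1 \<in> V" using X Y Z by auto
  then show ?thesis
    using jacobi_hpart[OF X Y Z(2)] jacobi_hpart[OF X Y Z(3)] Z(1)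
    by (simp add: scale_right_distrib)
qed

lemma bilinear_forms:
  "bilinear_map_on V (*s) (*) B" "bilinear_map_on V (*s) (*) \<omega>"
  using scalar_product symplectic
  unfolding odd_invariant_scalar_product_def odd_symplectic_form_def odd_form_def by blast+

lemma B_bilinear [simp]:
  assumes "X \<in> V" "Y \<in> V"
  shows "Z \<in> V \<Longrightarrow> B X (Y + Z) = B X Y + B X Z" "B X (c *s Y) = c * B X Y"
    "Z \<in> V \<Longrightarrow> B (X + Z) Y = B X Y + B Z Y" "B (c *s X) Y = c * B X Y"
  using bilinear_forms(1) assms unfolding bilinear_map_on_def linear_map_on_def by blast+

lemma \<omega>_bilinear [simp]:
  assumes "X \<in> V" "Y \<in> V"
  shows "Z \<in> V \<Longrightarrow> \<omega> X (Y + Z) = \<omega> X Y + \<omega> X Z" "\<omega> X (c *s Y) = c * \<omega> X Y"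
    "Z \<in> V \<Longrightarrow> \<omega> (X + Z) Y = \<omega> X Y + \<omega> Z Y" "\<omega> (c *s X) Y = c * \<omega> X Y"
  using bilinear_forms(2) assms unfolding bilinear_map_on_def linear_map_on_def by blast+

lemma B_zero [simp]: "X \<in> V \<Longrightarrow> B X 0 = 0" "X \<in> V \<Longrightarrow> B 0 X = 0"
  using B_bilinear(2)[of X 0 0] B_bilinear(4)[of 0 X 0] by auto

lemma B_minus [simp]:
  assumes "X \<in> V" "Y \<in> V"
  shows "B X (- Y) = - B X Y" "B (- X) Y = - B X Y"
    "Z \<in> V \<Longrightarrow> B X (Y - Z) = B X Y - B X Z" "Z \<in> V \<Longrightarrow> B (X - Z) Y = B X Y - B Z Y"
proof -
  show "B X (- Y) = - B X Y" "B (- X) Y = - B X Y"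
    using B_bilinear(2)[OF assms, of "-1"] B_bilinear(4)[OF assms, of "-1"] by simp_all
  show "B X (Y - Z) = B X Y - B X Z" if "Z \<in> V"
    using assms that B_bilinear(1)[of X "Y - Z" Z] by simp
  show "B (X - Z) Y = B X Y - B Z Y" if "Z \<in> V"
    using assms that B_bilinear(3)[of "X - Z" Y Z] by simp
qed

lemma B_odd [simp]: "X \<in> hpart g \<alpha> \<Longrightarrow> Y \<in> hpart g \<alpha> \<Longrightarrow> B X Y = 0"
  using scalar_product unfolding odd_invariant_scalar_product_def odd_form_def by blast

lemma \<omega>_odd [simp]: "X \<in> hpart g \<alpha> \<Longrightarrow> Y \<in> hpart g \<alpha> \<Longrightarrow> \<omega> X Y = 0"
  using symplectic unfolding odd_symplectic_form_def odd_form_def by blast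

text \<open>
  The sign of supersymmetry is nontrivial on odd pairs only, where an odd form vanishes. So \<open>B\<close> is
  symmetric and \<open>\<omega>\<close> is skew-symmetric in the ordinary sense, without signs.
\<close>

lemma B_sym: "X \<in> V \<Longrightarrow> Y \<in> V \<Longrightarrow> B X Y = B Y X"
proof -
  have hom: "B X Y = ksign \<alpha> \<beta> * B Y X" if "X \<in> hpart g \<alpha>" "Y \<in> hpart g \<beta>" for X Y \<alpha> \<beta>
    using scalar_product that unfolding odd_invariant_scalar_product_def by blast
  assume "X \<in> V" "Y \<in> V"
  then obtain X0 X1 Y0 Y1 where *: "X = X0 + X1" "X0 \<in> hpart g 0" "X1 \<in> hpart g 1"
    "Y = Y0 + Y1" "Y0 \<in> hpart g 0" "Y1 \<in> hpart g 1"
    using decompose[of X] decompose[of Y] by metis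
  then show ?thesis using hom[OF *(2,6)] hom[OF *(3,5)] by simp
qed

lemma \<omega>_skew: "X \<in> V \<Longrightarrow> Y \<in> V \<Longrightarrow> \<omega> X Y = - \<omega> Y X"
proof -
  have hom: "\<omega> X Y = - (ksign \<alpha> \<beta> * \<omega> Y X)" if "X \<in> hpart g \<alpha>" "Y \<in> hpart g \<beta>" for X Y \<alpha> \<beta>
    using symplectic that unfolding odd_symplectic_form_def by blast
  assume "X \<in> V" "Y \<in> V"
  then obtain X0 X1 Y0 Y1 where *: "X = X0 + X1" "X0 \<in> hpart g 0" "X1 \<in> hpart g 1"
    "Y = Y0 + Y1" "Y0 \<in> hpart g 0" "Y1 \<in> hpart g 1"
    using decompose[of X] decompose[of Y] by metis
  then show ?thesis using hom[OF *(2,6)] hom[OF *(3,5)] by simp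
qed

lemma B_invariant: "X \<in> V \<Longrightarrow> Y \<in> V \<Longrightarrow> Z \<in> V \<Longrightarrow> B (br X Y) Z = B X (br Y Z)"
  using scalar_product unfolding odd_invariant_scalar_product_def by blast

lemma \<omega>_closed:
  "X \<in> hpart g \<alpha> \<Longrightarrow> Y \<in> hpart g \<beta> \<Longrightarrow> Z \<in> hpart g \<gamma> \<Longrightarrow>
    ksign \<gamma> \<alpha> * \<omega> X (br Y Z) + ksign \<alpha> \<beta> * \<omega> Y (br Z X) + ksign \<beta> \<gamma> * \<omega> Z (br X Y) = 0"
  using symplectic unfolding odd_symplectic_form_def by blast

lemma B_nondegenerate: "X \<in> V \<Longrightarrow> (\<And>Y. Y \<in> V \<Longrightarrow> B X Y = 0) \<Longrightarrow> X = 0"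
  using scalar_product unfolding odd_invariant_scalar_product_def nondegenerate_form_def by blast

lemma \<omega>_nondegenerate: "X \<in> V \<Longrightarrow> (\<And>Y. Y \<in> V \<Longrightarrow> \<omega> X Y = 0) \<Longrightarrow> X = 0"
  using symplectic unfolding odd_symplectic_form_def nondegenerate_form_def by blast

lemma B_eqI:
  assumes "X \<in> V" "Y \<in> V" "\<And>\<alpha> Z. Z \<in> hpart g \<alpha> \<Longrightarrow> B X Z = B Y Z"
  shows "X = Y"
proof -
  have "B (X - Y) Z = 0" if Z: "Z \<in> V" for Z
  proof -
    obtain Z0 Z1 where Z01: "Z = Z0 + Z1" "Z0 \<in> hpart g 0" "Z1 \<in> hpart g 1"
      using decompose[OF Z] .
    then have "Z0 \<in> V" "Z1 \<in> V" by auto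
    then show ?thesis using assms(1,2) assms(3)[OF Z01(2)] assms(3)[OF Z01(3)] Z01(1) by simp
  qed
  then have "X - Y = 0" using assms(1,2) by (intro B_nondegenerate) simp_all
  then show ?thesis by simp
qed

text \<open>
  Each homogeneous part is its own orthogonal under the odd form \<open>B\<close>. This is how operators defined
  through \<open>B\<close> are seen to preserve degrees.
\<close>

lemma hpart_by_B:
  assumes "X \<in> V" "\<And>Y. Y \<in> hpart g \<alpha> \<Longrightarrow> B X Y = 0"
  shows "X \<in> hpart g \<alpha>"
proof -
  obtain X0 X1 where X: "X = X0 + X1" "X0 \<in> hpart g 0" "X1 \<in> hpart g 1"
    using decompose[OF assms(1)] .
  define Xa where "Xa = (if \<alpha> = 0 then X0 else X1)"
  define Xb where "Xb = (if \<alpha> = 0 then X1 else X0)"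
  have X': "X = Xa + Xb" "Xa \<in> hpart g \<alpha>" "Xb \<in> hpart g (\<alpha> + 1)"
    using X bit_cases[of \<alpha>] by (auto simp: Xa_def Xb_def add.commute)
  have "B Xb Y = 0" if "Y \<in> hpart g \<beta>" for \<beta> Y
  proof -
    have "\<beta> = \<alpha> \<or> \<beta> = \<alpha> + 1" using bit_cases[of \<alpha>] bit_cases[of \<beta>] by auto
    then show ?thesis
      using assms(2)[of Y] that X' by auto
  qed
  then have "Xb = 0" using X'(3) by (intro B_eqI[of Xb 0]) (simp_all add: X'(3) hpart_carr[OF X'(3)])
  with X' show ?thesis by simp
qed

lemma represent_functional:
  assumes F: "bilinear_map_on V (*s) (*) F"
    and nondeg: "\<And>Y. Y \<in> V \<Longrightarrow> (\<And>X. X \<in> V \<Longrightarrow> F X Y = 0) \<Longrightarrow> Y = 0"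
    and f: "linear_map_on V (*s) (*) f"
  shows "\<exists>Z\<in>V. \<forall>Y\<in>V. F Z Y = f Y"
proof -
  obtain S where S: "finite S" "V \<subseteq> span S" using finite_span by auto
  obtain b where b: "b \<subseteq> V" "independent b" "V \<subseteq> span b" using basis_exists by metis
  have "b \<subseteq> span S" using b(1) S(2) by (rule subset_trans)
  then have "finite b" using independent_span_bound[OF S(1) b(2)] by simp
  have F_add: "F (X + X') Y = F X Y + F X' Y" and F_scale: "F (c *s X) Y = c * F X Y"
    if "X \<in> V" "X' \<in> V" "Y \<in> V" for X X' Y c
    using F that unfolding bilinear_map_on_def linear_map_on_def by auto
  have F0: "F 0 Y = 0" if "Y \<in> V" for Y using F_scale[of 0 0 Y 0] that by simp
  have "f 0 = 0" using f unfolding linear_map_on_def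
    by (metis carr_closed(1) mult_zero_left scale_zero_left)
  have "\<exists>c. \<forall>Y\<in>V. f Y = (\<Sum>i\<in>b. c i * F i Y)"
  proof (rule functional_in_span[OF \<open>finite b\<close> subspace_carr f])
    show "linear_map_on V (*s) (*) (F i)" if "i \<in> b" for i
      using F that b(1) unfolding bilinear_map_on_def by blast
    fix Y assume Y: "Y \<in> V" "\<And>i. i \<in> b \<Longrightarrow> F i Y = 0"
    have "X \<in> V \<and> F X Y = 0" if "X \<in> span b" for X
      using that
    proof (induction rule: span_induct_alt)
      case (step c x y)
      then have "x \<in> V" using b(1) by auto
      with step Y show ?case by (simp add: F_add F_scale)
    qed (simp add: F0 Y(1))
    then have "Y = 0" using Y(1) subsetD[OF b(3)] by (intro nondeg) simp_all
    then show "f Y = 0" using \<open>f 0 = 0\<close> by simp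
  qed
  then obtain c where c: "\<And>Y. Y \<in> V \<Longrightarrow> f Y = (\<Sum>i\<in>b. c i * F i Y)" by auto
  have "\<exists>Z\<in>V. \<forall>Y\<in>V. F Z Y = (\<Sum>i\<in>I. c i * F i Y)" if "finite I" "I \<subseteq> V" for I
    using that
  proof (induction I)
    case empty
    then show ?case using F0 by (intro bexI[of _ 0]) simp_all
  next
    case (insert i I)
    then obtain Z where Z: "Z \<in> V" "\<And>Y. Y \<in> V \<Longrightarrow> F Z Y = (\<Sum>i\<in>I. c i * F i Y)" by auto
    with insert show ?case by (intro bexI[of _ "c i *s i + Z"]) (simp_all add: F_add F_scale)
  qed
  then show ?thesis using \<open>finite b\<close> b(1) c by simp
qed

text \<open>
  \<open>\<delta> X\<close> is the vector that represents \<open>\<omega>(X, \<sqdot>)\<close> by \<open>B\<close>. When \<open>\<delta>\<close> is moved out of the three terms, the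
  closedness of \<open>\<omega>\<close> turns into the Leibniz rule paired with \<open>Z\<close>. Exchanging the roles of the two
  forms gives surjectivity.
\<close>

theorem associated_derivation_exists: "\<exists>\<delta>. associated_derivation g \<delta>"
proof -
  have "\<exists>Z\<in>V. \<forall>Y\<in>V. B Z Y = \<omega> X Y" if "X \<in> V" for X
  proof (rule represent_functional[OF bilinear_forms(1)])
    show "Y = 0" if Y: "Y \<in> V" "\<And>X. X \<in> V \<Longrightarrow> B X Y = 0" for Y
      using Y B_sym[OF Y(1)] by (intro B_nondegenerate) simp_all
    show "linear_map_on V (*s) (*) (\<omega> X)"
      using bilinear_forms(2) that by (simp add: bilinear_map_on_def)
  qed
  then obtain \<delta> where \<delta>: "\<And>X. X \<in> V \<Longrightarrow> \<delta> X \<in> V"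
    and B\<delta>: "\<And>X Y. X \<in> V \<Longrightarrow> Y \<in> V \<Longrightarrow> B (\<delta> X) Y = \<omega> X Y"
    by metis
  have eq: "X = Y" if "X \<in> V" "Y \<in> V" "\<And>Z. Z \<in> V \<Longrightarrow> B X Z = B Y Z" for X Y
    using that by (intro B_eqI) simp_all
  have lin: "linear_map_on V (*s) (*s) \<delta>"
    unfolding linear_map_on_def by (auto intro!: eq simp: \<delta> B\<delta>)
  have even: "\<delta> X \<in> hpart g \<alpha>" if "X \<in> hpart g \<alpha>" for X \<alpha>
    using that by (intro hpart_by_B) (simp_all add: \<delta> B\<delta>)
  have der_hom: "\<delta> (br X Y) = br (\<delta> X) Y + br X (\<delta> Y)"
    if X: "X \<in> hpart g \<alpha>" and Y: "Y \<in> hpart g \<beta>" for X Y \<alpha> \<beta>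
  proof (rule B_eqI)
    have V: "X \<in> V" "Y \<in> V" using X Y by auto
    then show "\<delta> (br X Y) \<in> V" "br (\<delta> X) Y + br X (\<delta> Y) \<in> V" by (simp_all add: \<delta>)
    fix \<gamma> Z assume Z: "Z \<in> hpart g \<gamma>"
    then have "Z \<in> V" by auto
    have 1: "\<omega> X (br Y Z) = B (br (\<delta> X) Y) Z"
      using V \<open>Z \<in> V\<close> by (simp add: B_invariant \<delta> flip: B\<delta>)
    have "\<omega> Y (br Z X) = - (ksign \<gamma> \<alpha> * B (br (\<delta> Y) X) Z)"
      using V \<open>Z \<in> V\<close> by (simp add: B_invariant br_swap[OF Z X] \<delta> flip: B\<delta>)
    also have "br (\<delta> Y) X = - (ksign \<beta> \<alpha> *s br X (\<delta> Y))"
      using br_swap[OF even[OF Y] X] .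
    finally have 2: "\<omega> Y (br Z X) = ksign \<gamma> \<alpha> * ksign \<alpha> \<beta> * B (br X (\<delta> Y)) Z"
      using V \<open>Z \<in> V\<close> by (simp add: \<delta> ksign_commute)
    have 3: "\<omega> Z (br X Y) = - B (\<delta> (br X Y)) Z"
      using V \<open>Z \<in> V\<close> \<omega>_skew[of Z "br X Y"] by (simp add: B\<delta>)
    \<comment> \<open>The signs of the three terms agree unless \<open>Z\<close> has the degree of \<open>[X, Y]\<close>; then all vanish.\<close>
    have 0: "B (\<delta> (br X Y)) Z = 0 \<and> B (br (\<delta> X) Y) Z = 0 \<and> B (br X (\<delta> Y)) Z = 0"
      if "\<gamma> = \<alpha> + \<beta>"
      using that Z br_hpart[OF X Y] even br_hpart[OF even[OF X] Y] br_hpart[OF X even[OF Y]]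
      by (metis B_odd)
    show "B (\<delta> (br X Y)) Z = B (br (\<delta> X) Y + br X (\<delta> Y)) Z"
      using \<omega>_closed[OF X Y Z] V \<open>Z \<in> V\<close> 0 bit_cases[of \<alpha>] bit_cases[of \<beta>] bit_cases[of \<gamma>]
      unfolding 1 2 3 by (elim disjE) (simp_all add: \<delta> algebra_simps eq_neg_iff_add_eq_0)
  qed
  have der: "\<delta> (br X Y) = br (\<delta> X) Y + br X (\<delta> Y)" if X: "X \<in> hpart g \<alpha>" and Y: "Y \<in> V" for X Y \<alpha>
  proof -
    obtain Y0 Y1 where Y01: "Y = Y0 + Y1" "Y0 \<in> hpart g 0" "Y1 \<in> hpart g 1"
      using decompose[OF Y] .
    then have "Y0 \<in> V" "Y1 \<in> V" "X \<in> V" using X by auto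
    then show ?thesis
      using der_hom[OF X Y01(2)] der_hom[OF X Y01(3)] Y01(1) lin
      by (simp add: linear_map_on_def \<delta>)
  qed
  have "bij_betw \<delta> V V"
  proof (rule bij_betw_imageI)
    show "inj_on \<delta> V"
    proof (rule inj_onI)
      fix X Y assume XY: "X \<in> V" "Y \<in> V" "\<delta> X = \<delta> Y"
      have "\<omega> (X + (- 1) *s Y) Z = 0" if "Z \<in> V" for Z
        using XY that B\<delta>[OF XY(1) that] B\<delta>[OF XY(2) that]
          \<omega>_bilinear(3)[of X Z "(- 1) *s Y"] \<omega>_bilinear(4)[of Y Z "- 1"]
        by simp
      then have "X + (- 1) *s Y = 0" using XY(1,2) by (intro \<omega>_nondegenerate) simp_all
      then show "X = Y" by simp
    qed
    show "\<delta> ` V = V"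
    proof
      show "V \<subseteq> \<delta> ` V"
      proof
        fix Z assume Z: "Z \<in> V"
        have "\<exists>X\<in>V. \<forall>Y\<in>V. \<omega> X Y = B Z Y"
        proof (rule represent_functional[OF bilinear_forms(2)])
          show "Y = 0" if Y: "Y \<in> V" "\<And>X. X \<in> V \<Longrightarrow> \<omega> X Y = 0" for Y
            using Y \<omega>_skew[OF Y(1)] by (intro \<omega>_nondegenerate) simp_all
          show "linear_map_on V (*s) (*) (B Z)"
            using bilinear_forms(1) Z by (simp add: bilinear_map_on_def)
        qed
        then obtain X where "X \<in> V" "\<And>Y. Y \<in> V \<Longrightarrow> \<omega> X Y = B Z Y" by auto
        then have "\<delta> X = Z" using Z by (intro eq) (simp_all add: \<delta> B\<delta>)
        with \<open>X \<in> V\<close> show "Z \<in> \<delta> ` V" by blast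
      qed
    qed (use \<delta> in auto)
  qed
  then have "associated_derivation g \<delta>"
    using lin even der B\<delta>
    by (auto simp: associated_derivation_def superderivation_def)
  then show ?thesis by blast
qed

lemma parity_map_sum:
  assumes "X0 \<in> hpart g 0" "X1 \<in> hpart g 1"
  shows "parity_map g (X0 + X1) = X0 - X1"
proof -
  have uniq: "Y = X0" if "Y \<in> hpart g 0" "X0 + X1 - Y \<in> hpart g 1" for Y
  proof -
    have "X0 - Y = (X0 + X1 - Y) - X1" by simp
    also have "\<dots> \<in> hpart g 1" using that(2) assms(2) by (rule hpart_closed(3))
    finally have "X0 - Y \<in> hpart g 1" .
    then have "X0 - Y = 0" by (rule hpart_disjoint[OF hpart_closed(3)[OF assms(1) that(1)]])
    then show ?thesis by simp
  qed
  have uniq': "Y = X1" if "Y \<in> hpart g 1" "X0 + X1 - Y \<in> hpart g 0" for Y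
  proof -
    have "X1 - Y = (X0 + X1 - Y) - X0" by simp
    also have "\<dots> \<in> hpart g 0" using that(2) assms(1) by (rule hpart_closed(3))
    finally have "X1 - Y \<in> hpart g 0" .
    then have "X1 - Y = 0" by (rule hpart_disjoint[OF _ hpart_closed(3)[OF assms(2) that(1)]])
    then show ?thesis by simp
  qed
  have "homogeneous_component g 0 (X0 + X1) = X0"
    unfolding homogeneous_component_def
  proof (rule the_equality)
    show "X0 \<in> hpart g 0 \<and> X0 + X1 - X0 \<in> hpart g (0 + 1)" using assms by simp
    show "Y = X0" if "Y \<in> hpart g 0 \<and> X0 + X1 - Y \<in> hpart g (0 + 1)" for Y
      using that uniq[of Y] by simp
  qed
  moreover have "homogeneous_component g 1 (X0 + X1) = X1"
    unfolding homogeneous_component_def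
  proof (rule the_equality)
    show "X1 \<in> hpart g 1 \<and> X0 + X1 - X1 \<in> hpart g (1 + 1)" using assms by simp
    show "Y = X1" if "Y \<in> hpart g 1 \<and> X0 + X1 - Y \<in> hpart g (1 + 1)" for Y
      using that uniq'[of Y] by simp
  qed
  ultimately show ?thesis by (simp add: parity_map_def)
qed

context
  fixes \<delta>
  assumes \<delta>: "associated_derivation g \<delta>"
begin

lemma associated_derivation_simps:
  shows "X \<in> V \<Longrightarrow> \<delta> X \<in> V"
    and "X \<in> hpart g \<alpha> \<Longrightarrow> \<delta> X \<in> hpart g \<alpha>"
    and "X \<in> V \<Longrightarrow> Y \<in> V \<Longrightarrow> \<delta> (X + Y) = \<delta> X + \<delta> Y"
    and "X \<in> V \<Longrightarrow> \<delta> (c *s X) = c *s \<delta> X"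
    and "X \<in> V \<Longrightarrow> Y \<in> V \<Longrightarrow> B (\<delta> X) Y = \<omega> X Y"
proof -
  note \<delta>' = \<delta>[unfolded associated_derivation_def]
  have der: "superderivation g 0 \<delta>" using \<delta>' by (rule conjunct1)
  have bij: "bij_betw \<delta> V V" using \<delta>'[THEN conjunct2] by (rule conjunct1)
  have B\<delta>: "X \<in> V \<Longrightarrow> Y \<in> V \<Longrightarrow> \<omega> X Y = B (\<delta> X) Y" for X Y
    by (rule \<delta>'[THEN conjunct2, THEN conjunct2, rule_format])
  note der' = der[unfolded superderivation_def linear_map_on_def]
  show "X \<in> V \<Longrightarrow> \<delta> X \<in> V" by (rule bij_betwE[OF bij, rule_format])
  have "\<delta> ` hpart g \<alpha> \<subseteq> hpart g (\<alpha> + 0)"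
    using der'[THEN conjunct2, THEN conjunct1] by (rule spec)
  then show "X \<in> hpart g \<alpha> \<Longrightarrow> \<delta> X \<in> hpart g \<alpha>" unfolding add_0_right by (rule subsetD[OF _ imageI])
  show "X \<in> V \<Longrightarrow> Y \<in> V \<Longrightarrow> \<delta> (X + Y) = \<delta> X + \<delta> Y"
    by (rule der'[THEN conjunct1, THEN conjunct1, rule_format])
  show "X \<in> V \<Longrightarrow> \<delta> (c *s X) = c *s \<delta> X"
    by (rule der'[THEN conjunct1, THEN conjunct2, rule_format])
  show "X \<in> V \<Longrightarrow> Y \<in> V \<Longrightarrow> B (\<delta> X) Y = \<omega> X Y" by (rule B\<delta>[symmetric])
qed

lemma associated_derivation_injective: "X \<in> V \<Longrightarrow> \<delta> X = 0 \<Longrightarrow> X = 0"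
  by (rule \<omega>_nondegenerate) (simp_all flip: associated_derivation_simps(5))

lemma associated_derivation_skew: "X \<in> V \<Longrightarrow> Y \<in> V \<Longrightarrow> B (\<delta> X) Y = - B X (\<delta> Y)"
  using \<omega>_skew[of X Y] B_sym[of X "\<delta> Y"] by (simp add: associated_derivation_simps(1,5))

lemma associated_derivation_br:
  assumes "X \<in> V" "Y \<in> V"
  shows "\<delta> (br X Y) = br (\<delta> X) Y + br X (\<delta> Y)"
proof -
  have hom: "\<delta> (br X Y) = br (\<delta> X) Y + br X (\<delta> Y)" if "X \<in> hpart g \<alpha>" for \<alpha> X
  proof -
    have "\<delta> (br X Y) = br (\<delta> X) Y + ksign 0 \<alpha> *s br X (\<delta> Y)"
      using that assms(2)
      by (rule \<delta>[unfolded associated_derivation_def superderivation_def,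
            THEN conjunct1, THEN conjunct2, THEN conjunct2, rule_format])
    then show ?thesis by simp
  qed
  obtain X0 X1 where X: "X = X0 + X1" "X0 \<in> hpart g 0" "X1 \<in> hpart g 1"
    using decompose[OF assms(1)] .
  then have "X0 \<in> V" "X1 \<in> V" by auto
  then show ?thesis
    using hom[OF X(2)] hom[OF X(3)] X(1) assms(2) by (simp add: associated_derivation_simps)
qed

end

end

section \<open>An even central eigenvector\<close>

text \<open>
  The centre of the even part is central in the whole algebra: for \<open>es\<close> central in the even part, \<open>X\<close>
  odd and \<open>Z\<close> even, \<open>B([X, es], Z) = B(X, [es, Z]) = 0\<close>, while pairings of two odd elements
  vanish. The even part is nonzero, as otherwise the odd form \<open>B\<close> would be zero.
\<close>

theorem even_central_eigenvector:
  fixes g :: "('k::{alg_closed_field, field_char_0}, 'v::ab_group_add) superalgebra_forms"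
  assumes "odd_quadratic_odd_symplectic g" and \<delta>: "associated_derivation g \<delta>"
    and "carr g \<noteq> {0}"
  shows "\<exists>es\<in>hpart g 0. \<exists>l. es \<noteq> 0 \<and> \<delta> es = scl g l es \<and> (\<forall>X\<in>carr g. brk g X es = 0)"
proof -
  interpret odd_quadratic_odd_symplectic_algebra g
    by unfold_locales fact
  note \<delta>_simps = associated_derivation_simps[OF \<delta>]
  obtain S where S: "finite S" "V \<subseteq> span S" using finite_span by auto
  interpret L: lie_algebra_with_derivation "scl g" "hpart g 0" S \<delta> br
  proof unfold_locales
    show "hpart g 0 \<subseteq> span S" using S(2) hpart_carr[of _ 0] by (meson subset_iff)
    show "br X Y \<in> hpart g 0" if "X \<in> hpart g 0" "Y \<in> hpart g 0" for X Y
      using br_hpart[OF that] by simp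
    show "br X Y = - br Y X" if "X \<in> hpart g 0" "Y \<in> hpart g 0" for X Y
      using br_swap[OF that] by simp
    show "br X (br Y Z) = br (br X Y) Z + br Y (br X Z)"
      if "X \<in> hpart g 0" "Y \<in> hpart g 0" "Z \<in> hpart g 0" for X Y Z
      using jacobi_hpart[OF that] by simp
    show "\<delta> (br X Y) = br (\<delta> X) Y + br X (\<delta> Y)"
      if "X \<in> hpart g 0" "Y \<in> hpart g 0" for X Y
      using associated_derivation_br[OF \<delta>, of X Y] that by simp
    show "X = 0" if "X \<in> hpart g 0" "\<delta> X = 0" for X
      using associated_derivation_injective[OF \<delta>, of X] that by simp
  qed (simp_all add: subspace_hpart S \<delta>_simps)
  have "hpart g 0 \<noteq> {0}"
  proof
    assume 0: "hpart g 0 = {0}"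
    have "X = 0" if X: "X \<in> V" for X
    proof -
      have odd: "Y \<in> hpart g 1" if "Y \<in> V" for Y
        using decompose[OF that] 0 by auto
      show "X = 0" using X odd by (intro B_nondegenerate) (simp_all add: B_odd[of _ 1])
    qed
    then have "V = {0}" using carr_closed(1) by auto
    with assms(3) show False by simp
  qed
  from L.central_eigenvector[OF this] obtain es l
    where es: "es \<in> hpart g 0" "es \<noteq> 0" "\<delta> es = l *s es"
      and central: "\<And>X. X \<in> hpart g 0 \<Longrightarrow> br X es = 0" by auto
  have es_V: "es \<in> V" using es(1) by simp
  have "br X es = 0" if X: "X \<in> hpart g \<alpha>" for X \<alpha>
  proof (cases "\<alpha> = 0")
    case True
    then show ?thesis using X central by simp
  next
    case False
    then have X1: "X \<in> hpart g 1" using X bit_cases[of \<alpha>] by simp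
    have "B (br X es) Z = B 0 Z" if Z: "Z \<in> hpart g \<beta>" for \<beta> Z
    proof (cases "\<beta> = 0")
      case True
      then have "br es Z = 0" using br_swap[OF es(1) Z] central[of Z] Z by simp
      then show ?thesis using X1 Z es_V by (simp add: B_invariant)
    next
      case False
      then have "Z \<in> hpart g 1" using Z bit_cases[of \<beta>] by simp
      moreover have "br X es \<in> hpart g 1" using br_hpart[OF X1 es(1)] by simp
      ultimately have "B (br X es) Z = 0" by (rule B_odd[rotated])
      then show ?thesis using Z by simp
    qed
    then show ?thesis using X1 es_V by (intro B_eqI) simp_all
  qed
  then have "br X es = 0" if "X \<in> V" for X
    using decompose[OF that] es_V br_bilinear(3) hpart_carr by (metis add.right_neutral)
  with es show ?thesis by auto
qed

section \<open>Reduction along a central eigenvector\<close>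

text \<open>
  In the description of \<open>g\<close> as an extension, \<open>es\<close> is \<open>e\<^sup>*\<close> and \<open>l\<close> is \<open>\<lambda>\<close>.
\<close>

locale even_central_odd_quadratic_odd_symplectic = odd_quadratic_odd_symplectic_algebra g
  for g :: "('k::field_char_0, 'v::ab_group_add) superalgebra_forms" +
  fixes \<delta> :: "'v \<Rightarrow> 'v" and es e :: 'v and l :: 'k
  assumes \<delta>: "associated_derivation g \<delta>"
    and es_even: "es \<in> hpart g 0" and e_odd: "e \<in> hpart g 1"
    and pairing [simp]: "B es e = 1"
    and central [simp]: "X \<in> V \<Longrightarrow> br X es = 0"
    and eigen [simp]: "\<delta> es = l *s es"
begin

lemmas \<delta>_in [simp] = associated_derivation_simps(1)[OF \<delta>]
  and \<delta>_hpart = associated_derivation_simps(2)[OF \<delta>]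
  and \<delta>_linear [simp] = associated_derivation_simps(3,4)[OF \<delta>]
  and \<delta>_\<omega> = associated_derivation_simps(5)[OF \<delta>]
  and \<delta>_skew = associated_derivation_skew[OF \<delta>]
  and \<delta>_br = associated_derivation_br[OF \<delta>]

lemma \<delta>_diff [simp]: "X \<in> V \<Longrightarrow> Y \<in> V \<Longrightarrow> \<delta> (X - Y) = \<delta> X - \<delta> Y"
  using \<delta>_linear(1)[of "X - Y" Y] by simp

lemma es_e [simp]:
  "es \<in> V" "e \<in> V" "B e es = 1" "B es es = 0" "B e e = 0"
  using es_even e_odd B_sym[of e es] by simp_all

lemma central_left [simp]: "X \<in> V \<Longrightarrow> br es X = 0"
proof -
  assume X: "X \<in> V"
  obtain X0 X1 where *: "X = X0 + X1" "X0 \<in> hpart g 0" "X1 \<in> hpart g 1"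
    using decompose[OF X] .
  then have "X0 \<in> V" "X1 \<in> V" by auto
  then show ?thesis
    using br_swap[OF es_even *(2)] br_swap[OF es_even *(3)] *(1) by simp
qed

lemma l_nonzero: "l \<noteq> 0"
proof
  assume "l = 0"
  then have "es = 0" using associated_derivation_injective[OF \<delta>, of es] by simp
  then show False using pairing by simp
qed

text \<open>
  The orthogonal of the plane spanned by \<open>es\<close> and \<open>e\<close>, and the orthogonal projection onto it.
\<close>

definition core :: "'v set" where
  "core = {X \<in> V. B X e = 0 \<and> B X es = 0}"

definition proj :: "'v \<Rightarrow> 'v" where
  "proj X = X - B X e *s es - B X es *s e"

text \<open>
  Operations are set to zero outside the core, so that the reduction onto a zero core is literally
  the null superalgebra and not merely isomorphic to it.
\<close>

definition restrict_to_core :: "('v \<Rightarrow> 'v \<Rightarrow> 'c::zero) \<Rightarrow> 'v \<Rightarrow> 'v \<Rightarrow> 'c" where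
  "restrict_to_core f X Y = (if X \<in> core \<and> Y \<in> core then f X Y else 0)"

definition reduction :: "('k, 'v) superalgebra_forms" where
  "reduction = \<lparr> scl = scl g, hpart = (\<lambda>\<alpha>. hpart g \<alpha> \<inter> core),
     brk = restrict_to_core (\<lambda>X Y. proj (br X Y)),
     Bform = restrict_to_core B, symp = restrict_to_core \<omega> \<rparr>"

lemma core_closed [simp]:
  "0 \<in> core" "X \<in> core \<Longrightarrow> Y \<in> core \<Longrightarrow> X + Y \<in> core" "X \<in> core \<Longrightarrow> Y \<in> core \<Longrightarrow> X - Y \<in> core"
  "X \<in> core \<Longrightarrow> - X \<in> core" "X \<in> core \<Longrightarrow> c *s X \<in> core"
  by (simp_all add: core_def)

lemma proj_core [simp]: "X \<in> V \<Longrightarrow> proj X \<in> core"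
  by (simp add: core_def proj_def)

lemma core_carr [simp]: "X \<in> core \<Longrightarrow> X \<in> V"
  by (simp add: core_def)

lemma core_orthogonal [simp]:
  assumes "X \<in> core" shows "B X e = 0" "B X es = 0" "B e X = 0" "B es X = 0"
proof -
  show "B X e = 0" "B X es = 0" using assms unfolding core_def by blast+
  then show "B e X = 0" "B es X = 0" using assms B_sym[of e X] B_sym[of es X] by simp_all
qed

lemma proj_id [simp]: "X \<in> core \<Longrightarrow> proj X = X"
  by (simp add: proj_def)

lemma proj_linear [simp]:
  "X \<in> V \<Longrightarrow> Y \<in> V \<Longrightarrow> proj (X + Y) = proj X + proj Y"
  "X \<in> V \<Longrightarrow> Y \<in> V \<Longrightarrow> proj (X - Y) = proj X - proj Y"
  "X \<in> V \<Longrightarrow> proj (- X) = - proj X" "X \<in> V \<Longrightarrow> proj (c *s X) = c *s proj X"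
  by (simp_all add: proj_def algebra_simps)

lemma proj_es_e [simp]: "proj es = 0" "proj e = 0" "proj 0 = 0"
  by (simp_all add: proj_def)

lemma proj_hpart: "X \<in> hpart g \<alpha> \<Longrightarrow> proj X \<in> hpart g \<alpha>"
proof -
  assume X: "X \<in> hpart g \<alpha>"
  show ?thesis
  proof (cases "\<alpha> = 0")
    case True
    then have "B X es = 0" using X es_even B_odd by simp
    then show ?thesis using X True es_even by (simp add: proj_def)
  next
    case False
    then have 1: "\<alpha> = 1" using bit_cases[of \<alpha>] by simp
    then have "B X e = 0" using X e_odd B_odd by simp
    then show ?thesis using X 1 e_odd by (simp add: proj_def)
  qed
qed

lemma expand: "B X e *s es + proj X + B X es *s e = X"
  by (simp add: proj_def)

lemma core_eqI:
  assumes "X \<in> core" "Y \<in> core" "\<And>Z. Z \<in> core \<Longrightarrow> B X Z = B Y Z"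
  shows "X = Y"
proof (rule B_eqI)
  fix \<alpha> Z assume "Z \<in> hpart g \<alpha>"
  then have Z: "Z \<in> V" by auto
  have "B X (B Z e *s es + proj Z + B Z es *s e) = B Y (B Z e *s es + proj Z + B Z es *s e)"
    using assms Z by simp
  then show "B X Z = B Y Z" by (simp only: expand)
qed (use assms in auto)

lemma B_proj [simp]:
  "X \<in> V \<Longrightarrow> Y \<in> core \<Longrightarrow> B (proj X) Y = B X Y"
  "X \<in> V \<Longrightarrow> Y \<in> core \<Longrightarrow> B Y (proj X) = B Y X"
  by (simp_all add: proj_def)

lemma \<omega>_es [simp]: "X \<in> core \<Longrightarrow> \<omega> X es = 0"
  using \<delta>_\<omega>[of X es] \<delta>_skew[of X es] by simp

lemma \<omega>_proj_perp:
  "X \<in> V \<Longrightarrow> B X es = 0 \<Longrightarrow> Y \<in> core \<Longrightarrow> \<omega> Y (proj X) = \<omega> Y X"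
proof -
  assume "X \<in> V" "B X es = 0" "Y \<in> core"
  then have "\<omega> Y (B X e *s es + proj X + B X es *s e) = \<omega> Y (proj X)" by simp
  then show ?thesis by (simp only: expand)
qed

lemma br_perp [simp]: "X \<in> V \<Longrightarrow> Y \<in> V \<Longrightarrow> B (br X Y) es = 0"
  by (simp add: B_invariant)

lemma br_proj_perp:
  assumes "X \<in> V" "Y \<in> V" "B Y es = 0"
  shows "br X (proj Y) = br X Y" "br (proj Y) X = br Y X"
  using assms by (simp_all add: proj_def)

text \<open>
  Brackets are orthogonal to \<open>es\<close>, so projecting one only removes a multiple of the central \<open>es\<close>. The
  identities of \<open>g\<close> involving iterated brackets hence pass to the core by projecting them once.
\<close>

lemma br_proj_br [simp]:
  assumes "X \<in> V" "Y \<in> V" "Z \<in> V"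
  shows "br Z (proj (br X Y)) = br Z (br X Y)" "br (proj (br X Y)) Z = br (br X Y) Z"
  using assms by (simp_all add: br_proj_perp)

lemma \<delta>_core_perp: "X \<in> core \<Longrightarrow> B (\<delta> X) es = 0"
  using \<delta>_skew[of X es] by simp

lemma proj_\<delta>_perp:
  "X \<in> V \<Longrightarrow> B X es = 0 \<Longrightarrow> proj (\<delta> (proj X)) = proj (\<delta> X)"
  by (simp add: proj_def[of X])

lemma carr_reduction [simp]: "carr reduction = core"
proof
  show "carr reduction \<subseteq> core" by (auto simp: carr_def reduction_def)
  show "core \<subseteq> carr reduction"
  proof
    fix X assume X: "X \<in> core"
    obtain X0 X1 where *: "X = X0 + X1" "X0 \<in> hpart g 0" "X1 \<in> hpart g 1"
      using decompose[OF core_carr[OF X]] .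
    have "proj X = proj X0 + proj X1" using * by simp
    then have "X = proj X0 + proj X1" using X by simp
    moreover have "proj X0 \<in> hpart g 0 \<inter> core" "proj X1 \<in> hpart g 1 \<inter> core"
      using * by (auto intro: proj_hpart)
    ultimately show "X \<in> carr reduction" by (auto simp: carr_def reduction_def)
  qed
qed

lemma reduction_simps [simp]:
  "scl reduction = scl g"
  "X \<in> hpart reduction \<alpha> \<longleftrightarrow> X \<in> hpart g \<alpha> \<and> X \<in> core"
  "X \<in> core \<Longrightarrow> Y \<in> core \<Longrightarrow> brk reduction X Y = proj (br X Y)"
  "X \<in> core \<Longrightarrow> Y \<in> core \<Longrightarrow> Bform reduction X Y = B X Y"
  "X \<in> core \<Longrightarrow> Y \<in> core \<Longrightarrow> symp reduction X Y = \<omega> X Y"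
  by (simp_all add: reduction_def restrict_to_core_def)

lemma reduction_trivial:
  assumes "core = {0}" shows "reduction = null_superalgebra (scl g)"
  using assms
  by (auto simp: reduction_def null_superalgebra_def restrict_to_core_def fun_eq_iff)

lemma lie_superalgebra_reduction: "lie_superalgebra reduction"
  unfolding lie_superalgebra_def
proof (intro conjI allI ballI)
  show "vector_space (scl reduction)" by (simp add: vector_space_axioms)
  show "module.subspace (scl reduction) (hpart reduction \<alpha>)" for \<alpha>
    by (simp add: subspace_def)
  show "hpart reduction 0 \<inter> hpart reduction 1 = {0}" using hpart_disjoint by auto
  show "\<exists>S. finite S \<and> carr reduction \<subseteq> module.span (scl reduction) S"
  proof -
    obtain S where "finite S" "V \<subseteq> span S" using finite_span by auto
    moreover have "core \<subseteq> V" using core_carr by (rule subsetI)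
    ultimately show ?thesis by (intro exI[of _ S]) simp
  qed
  show "bilinear_map_on (carr reduction) (scl reduction) (scl reduction) (brk reduction)"
    by (simp add: bilinear_map_on_def linear_map_on_def)
next
  fix \<alpha> \<beta> X Y assume X: "X \<in> hpart reduction \<alpha>" and Y: "Y \<in> hpart reduction \<beta>"
  then have "br X Y \<in> hpart g (\<alpha> + \<beta>)" by (intro br_hpart) simp_all
  then have "proj (br X Y) \<in> hpart g (\<alpha> + \<beta>) \<and> proj (br X Y) \<in> core"
    using X Y by (intro conjI proj_hpart) simp_all
  then show "brk reduction X Y \<in> hpart reduction (\<alpha> + \<beta>)"
    using X Y by (simp only: reduction_simps)
  have "br X Y = - (ksign \<alpha> \<beta> *s br Y X)" using X Y by (intro br_swap) simp_all
  with X Y show "brk reduction X Y = - scl reduction (ksign \<alpha> \<beta>) (brk reduction Y X)" by simp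
next
  fix \<alpha> \<beta> \<gamma> X Y Z
  assume *: "X \<in> hpart reduction \<alpha>" "Y \<in> hpart reduction \<beta>" "Z \<in> hpart reduction \<gamma>"
  have "ksign \<alpha> \<gamma> *s br X (br Y Z) + ksign \<beta> \<alpha> *s br Y (br Z X) + ksign \<gamma> \<beta> *s br Z (br X Y) = 0"
  proof -
    have "X \<in> hpart g \<alpha>" "Y \<in> hpart g \<beta>" "Z \<in> hpart g \<gamma>" using * by simp_all
    then show ?thesis using lie unfolding lie_superalgebra_def by blast
  qed
  then have "proj (ksign \<alpha> \<gamma> *s br X (br Y Z) + ksign \<beta> \<alpha> *s br Y (br Z X)
      + ksign \<gamma> \<beta> *s br Z (br X Y)) = 0" by simp
  with * show "scl reduction (ksign \<alpha> \<gamma>) (brk reduction X (brk reduction Y Z))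
      + scl reduction (ksign \<beta> \<alpha>) (brk reduction Y (brk reduction Z X))
      + scl reduction (ksign \<gamma> \<beta>) (brk reduction Z (brk reduction X Y)) = 0"
    by simp
qed

lemma odd_invariant_scalar_product_reduction:
  "odd_invariant_scalar_product reduction (Bform reduction)"
  unfolding odd_invariant_scalar_product_def odd_form_def nondegenerate_form_def
proof (intro conjI allI ballI impI)
  show "bilinear_map_on (carr reduction) (scl reduction) (*) (Bform reduction)"
    by (simp add: bilinear_map_on_def linear_map_on_def)
next
  fix X assume X: "X \<in> carr reduction" "\<forall>Y\<in>carr reduction. Bform reduction X Y = 0"
  then show "X = 0" by (intro core_eqI) simp_all
next
  fix \<alpha> \<beta> X Y assume "X \<in> hpart reduction \<alpha>" "Y \<in> hpart reduction \<beta>"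
  then have *: "X \<in> hpart g \<alpha>" "Y \<in> hpart g \<beta>" "X \<in> core" "Y \<in> core" by simp_all
  have "B X Y = ksign \<alpha> \<beta> * B Y X"
    using scalar_product * unfolding odd_invariant_scalar_product_def by blast
  with * show "Bform reduction X Y = ksign \<alpha> \<beta> * Bform reduction Y X" by simp
next
  fix \<alpha> X Y assume "X \<in> hpart reduction \<alpha>" "Y \<in> hpart reduction \<alpha>"
  then show "Bform reduction X Y = 0" using B_odd[of X \<alpha> Y] by simp
qed (simp add: B_invariant)

text \<open>
  Non-degeneracy: if \<open>X\<close> in the core is \<open>\<omega>\<close>-orthogonal to the core, then \<open>\<delta> X\<close> is \<open>B\<close>-orthogonal to it and to \<open>es\<close>, hence
  a multiple of \<open>es = l\<inverse> \<delta> es\<close>. By injectivity of \<open>\<delta>\<close> also \<open>X\<close> is a multiple of \<open>es\<close>, and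
  \<open>B(X, e) = 0\<close> makes it zero.
\<close>

lemma odd_symplectic_form_reduction: "odd_symplectic_form reduction (symp reduction)"
  unfolding odd_symplectic_form_def odd_form_def nondegenerate_form_def
proof (intro conjI allI ballI impI)
  show "bilinear_map_on (carr reduction) (scl reduction) (*) (symp reduction)"
    by (simp add: bilinear_map_on_def linear_map_on_def)
next
  fix X assume X: "X \<in> carr reduction" "\<forall>Y\<in>carr reduction. symp reduction X Y = 0"
  then have X: "X \<in> core" "\<And>Y. Y \<in> core \<Longrightarrow> \<omega> X Y = 0" by simp_all
  define c where "c = B (\<delta> X) e"
  have "proj (\<delta> X) = 0"
  proof (rule core_eqI)
    show "B (proj (\<delta> X)) Z = B 0 Z" if "Z \<in> core" for Z
      using X(1) X(2)[OF that] that by (simp add: \<delta>_\<omega>)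
  qed (use X(1) in simp_all)
  moreover have "B (\<delta> X) e *s es + proj (\<delta> X) + B (\<delta> X) es *s e = \<delta> X"
    by (rule expand)
  ultimately have c: "c *s es = \<delta> X"
    unfolding \<delta>_core_perp[OF X(1)] c_def by simp
  have "\<delta> (X - (c / l) *s es) = \<delta> X - c *s es" using X(1) l_nonzero by simp
  also have "\<dots> = 0" unfolding c by simp
  finally have "X - (c / l) *s es = 0"
    using X(1) by (intro associated_derivation_injective[OF \<delta>, of "X - (c / l) *s es"]) simp_all
  then have X_es: "X = (c / l) *s es" by (simp only: right_minus_eq)
  then have "B X e = c / l" by simp
  then have "c / l = 0" using core_orthogonal(1)[OF X(1)] by (simp only:)
  then show "X = 0" unfolding X_es by (simp only: scale_zero_left)
next
  fix \<alpha> \<beta> X Y assume "X \<in> hpart reduction \<alpha>" "Y \<in> hpart reduction \<beta>"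
  then have *: "X \<in> hpart g \<alpha>" "Y \<in> hpart g \<beta>" "X \<in> core" "Y \<in> core" by simp_all
  have "\<omega> X Y = - (ksign \<alpha> \<beta> * \<omega> Y X)"
    using symplectic * unfolding odd_symplectic_form_def by blast
  with * show "symp reduction X Y = - (ksign \<alpha> \<beta> * symp reduction Y X)" by simp
next
  fix \<alpha> \<beta> \<gamma> X Y Z
  assume *: "X \<in> hpart reduction \<alpha>" "Y \<in> hpart reduction \<beta>" "Z \<in> hpart reduction \<gamma>"
  then show "ksign \<gamma> \<alpha> * symp reduction X (brk reduction Y Z)
      + ksign \<alpha> \<beta> * symp reduction Y (brk reduction Z X)
      + ksign \<beta> \<gamma> * symp reduction Z (brk reduction X Y) = 0"
    using \<omega>_closed[of X \<alpha> Y \<beta> Z \<gamma>] by (simp add: \<omega>_proj_perp)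
next
  fix \<alpha> X Y assume "X \<in> hpart reduction \<alpha>" "Y \<in> hpart reduction \<alpha>"
  then show "symp reduction X Y = 0" using \<omega>_odd[of X \<alpha> Y] by simp
qed

lemma odd_quadratic_odd_symplectic_reduction: "odd_quadratic_odd_symplectic reduction"
  by (simp add: odd_quadratic_odd_symplectic_def lie_superalgebra_reduction
      odd_invariant_scalar_product_reduction odd_symplectic_form_reduction)

section \<open>The extension data of the reduction\<close>

definition D :: "'v \<Rightarrow> 'v" where
  "D X = proj (br e X)"

definition x\<^sub>0 :: 'v where
  "x\<^sub>0 = proj (br e e)"

definition c\<^sub>1 :: 'v where
  "c\<^sub>1 = proj (\<delta> e)"

definition k :: 'k where
  "k = B (br e e) e"

lemma in_core [simp]: "X \<in> V \<Longrightarrow> D X \<in> core" "x\<^sub>0 \<in> core" "c\<^sub>1 \<in> core"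
  by (simp_all add: D_def x\<^sub>0_def c\<^sub>1_def)

lemma x\<^sub>0_hpart: "x\<^sub>0 \<in> hpart g 0"
  using br_hpart[OF e_odd e_odd] by (simp add: x\<^sub>0_def proj_hpart)

lemma c\<^sub>1_hpart: "c\<^sub>1 \<in> hpart g 1"
  by (simp add: c\<^sub>1_def proj_hpart \<delta>_hpart e_odd)

lemma D_hpart: "X \<in> hpart g \<alpha> \<Longrightarrow> D X \<in> hpart g (\<alpha> + 1)"
  using br_hpart[OF e_odd, of X \<alpha>] unfolding D_def by (subst add.commute) (rule proj_hpart)

lemma br_e_e: "br e e = k *s es + x\<^sub>0"
  using expand[of "br e e"] by (simp add: k_def x\<^sub>0_def)

lemma \<delta>_e: "\<delta> e = c\<^sub>1 - l *s e"
proof -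
  have "B (\<delta> e) e = 0" using B_odd[OF \<delta>_hpart[OF e_odd] e_odd] .
  moreover have "B (\<delta> e) es = - l" using \<delta>_skew[of e es] by simp
  ultimately show ?thesis using expand[of "\<delta> e"] by (simp add: c\<^sub>1_def)
qed

lemma br_e_odd: "X \<in> hpart g 1 \<Longrightarrow> br X e = br e X"
  using br_swap[OF _ e_odd] by simp

lemma br_e_even: "X \<in> hpart g 0 \<Longrightarrow> br X e = - br e X"
  using br_swap[OF _ e_odd] by simp

lemma br_x\<^sub>0: "X \<in> V \<Longrightarrow> br x\<^sub>0 X = br (br e e) X" "X \<in> V \<Longrightarrow> br X x\<^sub>0 = br X (br e e)"
  by (simp_all add: br_e_e)

lemma br_e_twice: "X \<in> V \<Longrightarrow> 2 *s br e (br e X) = br (br e e) X"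
proof -
  assume X: "X \<in> V"
  have *: "br e (br e X) = br (br e e) X - br e (br e X)"
    using jacobi[OF e_odd e_odd X] unfolding ksign_simps scale_minus_left scale_one
      add_uminus_conv_diff .
  have "2 *s br e (br e X) = br e (br e X) + br e (br e X)"
    by (simp only: one_add_one[symmetric] scale_left_distrib scale_one)
  also have "\<dots> = br (br e e) X" using * by (simp only: eq_diff_eq)
  finally show ?thesis .
qed

text \<open>
  The Jacobi identity for three copies of the odd \<open>e\<close> reads \<open>3 [e, [e, e]] = 0\<close>.
\<close>

lemma br_e_br_e_e: "br e (br e e) = 0"
proof -
  have "2 *s br e (br e e) = br (br e e) e" by (rule br_e_twice) simp
  also have "\<dots> = - br e (br e e)"
    using br_hpart[OF e_odd e_odd] by (intro br_e_even) simp
  finally have "2 *s br e (br e e) + 1 *s br e (br e e) = 0" by simp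
  then have "(2 + 1) *s br e (br e e) = 0" by (simp only: scale_left_distrib)
  then show ?thesis by simp
qed

lemma D_linear [simp]:
  "X \<in> V \<Longrightarrow> Y \<in> V \<Longrightarrow> D (X + Y) = D X + D Y" "X \<in> V \<Longrightarrow> Y \<in> V \<Longrightarrow> D (X - Y) = D X - D Y"
  "X \<in> V \<Longrightarrow> D (c *s X) = c *s D X"
  by (simp_all add: D_def)

text \<open>
  The Leibniz rule \<open>\<delta> [e, e] = 2 [e, \<delta> e]\<close> with \<open>\<delta> e = c\<^sub>1 - l e\<close> and \<open>[e, e] = x\<^sub>0 + k es\<close>: its core
  component is the first equation. Its \<open>es\<close>-component is \<open>3 B(c\<^sub>1, x\<^sub>0) = 3 l k\<close>.
\<close>

lemma \<delta>_br_e_e: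
  "2 *s D c\<^sub>1 = proj (\<delta> x\<^sub>0) + (2 * l) *s x\<^sub>0" "B c\<^sub>1 x\<^sub>0 = l * k"
proof -
  have "br c\<^sub>1 e = br e c\<^sub>1" using c\<^sub>1_hpart by (rule br_e_odd)
  have twice: "2 *s X = X + X" for X
    by (simp only: one_add_one[symmetric] scale_left_distrib scale_one)
  have "\<delta> (br e e) = br (c\<^sub>1 - l *s e) e + br e (c\<^sub>1 - l *s e)"
    by (simp only: \<delta>_br[OF es_e(2) es_e(2)] \<delta>_e)
  also have "\<dots> = (br e c\<^sub>1 + br e c\<^sub>1) - (l *s br e e + l *s br e e)"
    by (simp add: \<open>br c\<^sub>1 e = br e c\<^sub>1\<close>)
  also have "\<dots> = 2 *s br e c\<^sub>1 - (2 * l) *s br e e"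
    by (simp only: twice mult_2 scale_left_distrib)
  finally have *: "(k * l) *s es + \<delta> x\<^sub>0 = 2 *s br e c\<^sub>1 - (2 * l) *s (k *s es + x\<^sub>0)"
    by (simp add: br_e_e)
  from arg_cong[OF *, of proj] have "proj (\<delta> x\<^sub>0) = 2 *s D c\<^sub>1 - (2 * l) *s x\<^sub>0"
    by (simp add: D_def)
  then show "2 *s D c\<^sub>1 = proj (\<delta> x\<^sub>0) + (2 * l) *s x\<^sub>0" by (simp only: diff_add_cancel)
  have "B (\<delta> x\<^sub>0) e = - B x\<^sub>0 c\<^sub>1" using \<delta>_skew[of x\<^sub>0 e] \<delta>_e by simp
  moreover have "B (br e c\<^sub>1) e = B x\<^sub>0 c\<^sub>1"
    using B_invariant[of e e c\<^sub>1] B_sym[of "br e c\<^sub>1" e] by (simp add: br_e_e)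
  ultimately have "k * l - B x\<^sub>0 c\<^sub>1 = 2 * B x\<^sub>0 c\<^sub>1 - 2 * l * k"
    using arg_cong[OF *, of "\<lambda>X. B X e"] by simp
  then have "3 * B x\<^sub>0 c\<^sub>1 = 3 * (l * k)" by algebra
  then show "B c\<^sub>1 x\<^sub>0 = l * k" using B_sym[of c\<^sub>1 x\<^sub>0] by simp
qed

text \<open>
  Each condition is an identity in \<open>g\<close> projected to the core: \<open>D\<close> inherits its properties from \<open>ad e\<close>,
  its square comes from \<open>2 (ad e)\<^sup>2 = ad [e, e]\<close>, and the commutation rule with \<open>\<delta>\<close> from
  \<open>\<delta> [e, X] = [\<delta> e, X] + [e, \<delta> X]\<close>. The derivation attached to the reduction is the projection of \<open>\<delta>\<close>,
  because it is determined by the two forms.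
\<close>

lemma extension_data_reduction:
  assumes d: "associated_derivation reduction d"
  shows "extension_data reduction d D x\<^sub>0 k c\<^sub>1 l"
    and "X \<in> core \<Longrightarrow> d X = proj (\<delta> X)"
proof -
  interpret h: odd_quadratic_odd_symplectic_algebra reduction
    by unfold_locales (rule odd_quadratic_odd_symplectic_reduction)
  have d_eq: "d X = proj (\<delta> X)" if "X \<in> core" for X
  proof (rule core_eqI)
    show "d X \<in> core" using h.associated_derivation_simps(1)[OF d] that by simp
    fix Z assume "Z \<in> core"
    then show "B (d X) Z = B (proj (\<delta> X)) Z"
      using h.associated_derivation_simps(5)[OF d, of X Z] that \<open>d X \<in> core\<close>
      by (simp add: \<delta>_\<omega>)
  qed (use that in simp)
  then show "X \<in> core \<Longrightarrow> d X = proj (\<delta> X)" .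
  show "extension_data reduction d D x\<^sub>0 k c\<^sub>1 l"
    unfolding extension_data_def
  proof (intro conjI ballI)
    show "superderivation reduction 1 D"
      unfolding superderivation_def
    proof (intro conjI allI ballI)
      show "linear_map_on (carr reduction) (scl reduction) (scl reduction) D"
        by (simp add: linear_map_on_def)
      show "D ` hpart reduction \<alpha> \<subseteq> hpart reduction (\<alpha> + 1)" for \<alpha>
      proof (rule image_subsetI)
        fix X assume "X \<in> hpart reduction \<alpha>"
        then have "D X \<in> hpart g (\<alpha> + 1) \<and> D X \<in> core"
          by (intro conjI D_hpart in_core) simp_all
        then show "D X \<in> hpart reduction (\<alpha> + 1)" by (simp only: reduction_simps)
      qed
      fix \<alpha> X Y assume "X \<in> hpart reduction \<alpha>" "Y \<in> carr reduction"
      then show "D (brk reduction X Y)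
          = brk reduction (D X) Y + scl reduction (ksign 1 \<alpha>) (brk reduction X (D Y))"
        using jacobi[OF e_odd, of X \<alpha> Y] by (simp add: D_def)
    qed
    show "skew_supersymmetric reduction 1 D"
      unfolding skew_supersymmetric_def
    proof (intro allI ballI)
      fix \<alpha> X Y assume "X \<in> hpart reduction \<alpha>" "Y \<in> carr reduction"
      then show "Bform reduction (D X) Y = - (ksign 1 \<alpha> * Bform reduction X (D Y))"
        using br_swap[OF e_odd, of X \<alpha>] by (simp add: D_def B_invariant)
    qed
    show "D x\<^sub>0 = 0" by (simp add: D_def br_x\<^sub>0 br_e_br_e_e)
    show "D (D X) = scl reduction (1 / 2) (brk reduction x\<^sub>0 X)" if "X \<in> carr reduction" for X
      using that br_e_twice[of X, symmetric] by (simp add: D_def br_x\<^sub>0)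
    show "Bform reduction c\<^sub>1 x\<^sub>0 = l * k" using \<delta>_br_e_e(2) by simp
    show "scl reduction 2 (D c\<^sub>1) = d x\<^sub>0 + scl reduction (2 * l) x\<^sub>0"
      using \<delta>_br_e_e(1) by (simp add: d_eq)
    show "supercommutator reduction 0 1 d D X + scl reduction l (D X) = brk reduction c\<^sub>1 X"
      if "X \<in> carr reduction" for X
    proof -
      have X: "X \<in> core" "X \<in> V" using that by simp_all
      have "d (D X) = proj (\<delta> (br e X))"
        using X by (simp add: d_eq D_def proj_\<delta>_perp)
      also have "\<delta> (br e X) = br c\<^sub>1 X - l *s br e X + br e (\<delta> X)"
        using X by (simp add: \<delta>_br \<delta>_e)
      also have "br e (\<delta> X) = br e (d X)"
        using X by (simp add: d_eq br_proj_perp \<delta>_core_perp)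
      finally show ?thesis
        using X d_eq[OF X(1)] by (simp add: supercommutator_def D_def)
    qed
  qed (simp_all add: odd_quadratic_odd_symplectic_reduction d x\<^sub>0_hpart c\<^sub>1_hpart l_nonzero)
qed

section \<open>The algebra as an extension of its reduction\<close>

lemma associated_derivation_reduction: "\<exists>d. associated_derivation reduction d"
proof -
  interpret h: odd_quadratic_odd_symplectic_algebra reduction
    by unfold_locales (rule odd_quadratic_odd_symplectic_reduction)
  show ?thesis by (rule h.associated_derivation_exists)
qed

text \<open>
  The bracket of the extension is written with \<open>e\<close> on the left; the parity map accounts for the sign
  in \<open>[X, e] = - (-1)\<^sup>|\<^sup>X\<^sup>| [e, X]\<close>.
\<close>

lemma parity_map_reduction:
  assumes "X \<in> core"
  shows "parity_map reduction X \<in> core" "br X e = - br e (parity_map reduction X)"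
proof -
  interpret h: odd_quadratic_odd_symplectic_algebra reduction
    by unfold_locales (rule odd_quadratic_odd_symplectic_reduction)
  obtain X0 X1 where X: "X = X0 + X1" "X0 \<in> hpart reduction 0" "X1 \<in> hpart reduction 1"
    using h.decompose[of X] assms by auto
  then have core: "X0 \<in> core" "X1 \<in> core" by simp_all
  have par: "parity_map reduction X = X0 - X1"
    unfolding X(1) using X(2,3) by (rule h.parity_map_sum)
  show "parity_map reduction X \<in> core" unfolding par using core by simp
  have "br X0 e = - br e X0" using X(2) by (intro br_e_even) simp
  moreover have "br X1 e = br e X1" using X(3) by (intro br_e_odd) simp
  ultimately show "br X e = - br e (parity_map reduction X)"
    unfolding par unfolding X(1) using core by simp
qed

lemma br_expand:
  assumes "X \<in> V" "Y \<in> V"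
  shows "br X Y = br (proj X) (proj Y) + B X es *s br e (proj Y)
    - B Y es *s br e (parity_map reduction (proj X)) + (B X es * B Y es) *s br e e"
proof -
  have "br X Y = br (B X e *s es + proj X + B X es *s e) (B Y e *s es + proj Y + B Y es *s e)"
    by (simp only: expand)
  also have "\<dots> = br (proj X) (proj Y) + B X es *s br e (proj Y)
      + B Y es *s br (proj X) e + (B X es * B Y es) *s br e e"
    using assms by (simp add: scale_right_distrib mult.commute)
  finally show ?thesis
    using parity_map_reduction(2)[of "proj X"] assms by simp
qed

lemma B_br_e: "X \<in> V \<Longrightarrow> Y \<in> core \<Longrightarrow> B (br X Y) e = B (proj (br e X)) Y"
  using B_sym[of "br X Y" e] B_invariant[of e X Y] by simp

lemma B_expand:
  assumes "X \<in> V" "Y \<in> V"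
  shows "B X Y = B (proj X) (proj Y) + B X e * B Y es + B X es * B Y e"
proof -
  have "B X Y = B (B X e *s es + proj X + B X es *s e) (B Y e *s es + proj Y + B Y es *s e)"
    by (simp only: expand)
  also have "\<dots> = B (proj X) (proj Y) + B X e * B Y es + B X es * B Y e"
    using assms core_orthogonal[OF proj_core[OF assms(1)]] core_orthogonal[OF proj_core[OF assms(2)]]
    by (simp del: B_proj add: algebra_simps)
  finally show ?thesis .
qed

definition coordinates :: "'v \<Rightarrow> 'k \<times> 'v \<times> 'k" where
  "coordinates X = (B X e, proj X, B X es)"

lemma coordinates_\<delta>:
  assumes d: "associated_derivation reduction d" and X: "X \<in> V"
  shows "coordinates (\<delta> X) = ext_derivation reduction d c\<^sub>1 l (coordinates X)"
proof -
  have "B (\<delta> X) e = l * B X e - B X c\<^sub>1"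
    using \<delta>_skew[OF X es_e(2)] X by (simp add: \<delta>_e)
  moreover have "B X c\<^sub>1 = B c\<^sub>1 (proj X)"
    using X B_sym[of X c\<^sub>1] by simp
  moreover have "B (\<delta> X) es = - (l * B X es)"
    using \<delta>_skew[OF X es_e(1)] X by simp
  moreover have "proj (\<delta> X) = d (proj X) + B X es *s c\<^sub>1"
  proof -
    have "proj (\<delta> X) = proj (\<delta> (B X e *s es + proj X + B X es *s e))"
      by (simp only: expand)
    also have "\<dots> = proj (\<delta> (proj X)) + B X es *s c\<^sub>1"
      using X by (simp add: c\<^sub>1_def)
    also have "proj (\<delta> (proj X)) = d (proj X)"
      using extension_data_reduction(2)[OF d, of "proj X"] X by simp
    finally show ?thesis .
  qed
  ultimately show ?thesis
    using X by (simp add: coordinates_def ext_derivation_def)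
qed

text \<open>
  The coordinates \<open>(B(X, e), proj X, B(X, es))\<close> of \<open>X\<close> define the isomorphism: the formulas that
  define the extension are the expansions \<open>br_expand\<close>, \<open>B_expand\<close> and \<open>coordinates_\<delta>\<close>.
\<close>

theorem is_gen_odd_double_ext_reduction: "is_gen_odd_double_ext reduction g"
proof -
  obtain d where d: "associated_derivation reduction d"
    using associated_derivation_reduction by auto
  define E where "E = gen_odd_double_ext reduction d D x\<^sub>0 k c\<^sub>1 l"
  have hpart_E: "hpart E \<alpha> = (if \<alpha> = 0 then UNIV \<times> (hpart g 0 \<inter> core) \<times> {0}
      else {0} \<times> (hpart g 1 \<inter> core) \<times> UNIV)" for \<alpha>
    by (simp add: E_def gen_odd_double_ext_def reduction_def)
  have carr_E: "carr E = UNIV \<times> core \<times> UNIV"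
  proof
    show "carr E \<subseteq> UNIV \<times> core \<times> UNIV" by (auto simp: carr_def hpart_E)
    show "UNIV \<times> core \<times> UNIV \<subseteq> carr E"
    proof
      fix P :: "'k \<times> 'v \<times> 'k" assume "P \<in> UNIV \<times> core \<times> UNIV"
      then obtain a X b where P: "P = (a, X, b)" "X \<in> core" by (cases P) auto
      then have "X \<in> carr reduction" by simp
      then obtain X0 X1 where X: "X = X0 + X1" "X0 \<in> hpart g 0 \<inter> core" "X1 \<in> hpart g 1 \<inter> core"
        unfolding carr_def reduction_def by auto
      have "P = (a, X0, 0) + (0, X1, b)" using P(1) X(1) by simp
      moreover have "(a, X0, 0) \<in> hpart E 0" "(0, X1, b) \<in> hpart E 1"
        using X by (simp_all add: hpart_E)
      ultimately show "P \<in> carr E" unfolding carr_def by blast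
    qed
  qed
  have form_E: "Bform E (coordinates X) (coordinates Y) = B X Y" if "X \<in> V" "Y \<in> V" for X Y
    using that B_expand[OF that]
    by (simp add: E_def gen_odd_double_ext_def ext_form_def coordinates_def)
  have "isomorphic_forms g E"
    unfolding isomorphic_forms_def
  proof (intro exI conjI allI ballI)
    show "linear_map_on V (*s) (scl E) coordinates"
      by (simp add: linear_map_on_def E_def gen_odd_double_ext_def coordinates_def)
    show "bij_betw coordinates V (carr E)"
    proof (rule bij_betw_byWitness)
      show "\<forall>X\<in>V. (\<lambda>(a, X, b). a *s es + X + b *s e) (coordinates X) = X"
        by (simp add: coordinates_def expand)
      show "\<forall>P\<in>carr E. coordinates ((\<lambda>(a, X, b). a *s es + X + b *s e) P) = P"
        by (auto simp: carr_E coordinates_def)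
      show "coordinates ` V \<subseteq> carr E" by (auto simp: carr_E coordinates_def)
      show "(\<lambda>(a, X, b). a *s es + X + b *s e) ` carr E \<subseteq> V" by (auto simp: carr_E)
    qed
    show "coordinates ` hpart g \<alpha> \<subseteq> hpart E \<alpha>" for \<alpha>
    proof
      fix P assume "P \<in> coordinates ` hpart g \<alpha>"
      then obtain X where P: "P = coordinates X" and X: "X \<in> hpart g \<alpha>" by auto
      show "P \<in> hpart E \<alpha>"
      proof (cases "\<alpha> = 0")
        case True
        then have "B X es = 0" using X es_even B_odd by simp
        then show ?thesis using P X True proj_hpart[of X 0] by (simp add: hpart_E coordinates_def)
      next
        case False
        then have 1: "\<alpha> = 1" using bit_cases[of \<alpha>] by simp
        then have "B X e = 0" using X e_odd B_odd by simp
        then show ?thesis using P X 1 proj_hpart[of X 1] by (simp add: hpart_E coordinates_def)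
      qed
    qed
  next
    fix X Y assume X: "X \<in> V" and Y: "Y \<in> V"
    have par: "parity_map reduction (proj X) \<in> core"
      using X by (intro parity_map_reduction) simp
    have "B (br X Y) e = B (D (proj X)) (proj Y) + B X es * B x\<^sub>0 (proj Y)
        - B Y es * B x\<^sub>0 (parity_map reduction (proj X)) + B X es * B Y es * k"
      unfolding br_expand[OF X Y] using X Y par
      by (simp add: B_br_e D_def x\<^sub>0_def k_def)
    moreover have "proj (br X Y) = proj (br (proj X) (proj Y)) + B X es *s D (proj Y)
        - B Y es *s D (parity_map reduction (proj X)) + (B X es * B Y es) *s x\<^sub>0"
      unfolding br_expand[OF X Y] using X Y par
      by (simp add: D_def x\<^sub>0_def)
    ultimately show "coordinates (br X Y) = brk E (coordinates X) (coordinates Y)"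
      using X Y par
      by (simp add: E_def gen_odd_double_ext_def ext_bracket_def coordinates_def)
    show "Bform E (coordinates X) (coordinates Y) = B X Y" using X Y by (rule form_E)
    have "symp E (coordinates X) (coordinates Y) = Bform E (coordinates (\<delta> X)) (coordinates Y)"
      unfolding coordinates_\<delta>[OF d X] by (simp add: E_def gen_odd_double_ext_def)
    then show "symp E (coordinates X) (coordinates Y) = \<omega> X Y"
      using X Y by (simp add: form_E \<delta>_\<omega>)
  qed
  then show ?thesis
    unfolding is_gen_odd_double_ext_def E_def
    using odd_quadratic_odd_symplectic extension_data_reduction(1)[OF d] by blast
qed

lemma dim_core_less: "dim core < dim V"
proof -
  obtain S where S: "finite S" "V \<subseteq> span S" using finite_span by auto
  have "subspace core" by (simp add: subspace_def)
  then have span_core: "span core = core" by simp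
  have "es \<notin> core" using pairing core_orthogonal(1)[of es] by auto
  then have "es \<notin> span core" unfolding span_core .
  moreover have "core \<subseteq> span V" by (intro subsetI span_base core_carr)
  moreover have "es \<in> span V" by (intro span_base es_e)
  ultimately show ?thesis using dim_less_of_proper_span[OF S] by simp
qed

end

section \<open>Induction on the dimension\<close>

theorem corollary4p3:
  fixes g :: "('k :: {alg_closed_field, field_char_0}, 'v :: ab_group_add) superalgebra_forms"
  assumes "odd_quadratic_odd_symplectic g"
    and "carr g \<noteq> {0}"
  shows "is_gen_odd_double_ext\<^sup>+\<^sup>+ (null_superalgebra (scl g)) g"
  using assms
proof (induction "vector_space.dim (scl g) (carr g)" arbitrary: g rule: less_induct)
  case less
  interpret odd_quadratic_odd_symplectic_algebra g by unfold_locales (rule less.prems(1))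
  obtain \<delta> where \<delta>: "associated_derivation g \<delta>" using associated_derivation_exists by auto
  obtain es l where es: "es \<in> hpart g 0" "es \<noteq> 0" "\<delta> es = scl g l es"
    and central: "\<And>X. X \<in> V \<Longrightarrow> br X es = 0"
    using even_central_eigenvector[OF less.prems(1) \<delta> less.prems(2)] by auto
  \<comment> \<open>An odd form pairs the even \<open>es\<close> nontrivially with odd vectors only.\<close>
  have "\<exists>e\<in>hpart g 1. B es e = 1"
  proof (rule ccontr)
    assume *: "\<not> (\<exists>e\<in>hpart g 1. B es e = 1)"
    have "B es Y = B 0 Y" if Y: "Y \<in> hpart g \<alpha>" for \<alpha> Y
    proof (cases "\<alpha> = 0")
      case True
      then show ?thesis using B_odd[of es 0 Y] Y es(1) by simp
    next
      case False
      then have Y1: "Y \<in> hpart g 1" using Y bit_cases[of \<alpha>] by simp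
      have "B es Y = 0"
      proof (rule ccontr)
        assume "B es Y \<noteq> 0"
        then have "B es (scl g (1 / B es Y) Y) = 1" using es(1) Y by simp
        then show False using * Y1 by (meson hpart_closed(5))
      qed
      then show ?thesis using Y by simp
    qed
    then have "es = 0" using es(1) by (intro B_eqI) simp_all
    with es(2) show False by simp
  qed
  then obtain e where e: "e \<in> hpart g 1" "B es e = 1" by auto
  interpret even_central_odd_quadratic_odd_symplectic g \<delta> es e l
    by unfold_locales (use \<delta> es e central in auto)
  have step: "is_gen_odd_double_ext reduction g" by (rule is_gen_odd_double_ext_reduction)
  show ?case
  proof (cases "core = {0}")
    case True
    show ?thesis
      using step unfolding reduction_trivial[OF True] by (rule tranclp.r_into_trancl)
  next
    case False
    have "is_gen_odd_double_ext\<^sup>+\<^sup>+ (null_superalgebra (scl reduction)) reduction"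
    proof (rule less.hyps)
      show "vector_space.dim (scl reduction) (carr reduction) < dim V" using dim_core_less by simp
      show "carr reduction \<noteq> {0}" using False by simp
    qed (rule odd_quadratic_odd_symplectic_reduction)
    then have "is_gen_odd_double_ext\<^sup>+\<^sup>+ (null_superalgebra (scl g)) reduction" by simp
    then show ?thesis using step by (rule tranclp.trancl_into_trancl)
  qed
qed

end
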